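(* Let $\mathcal{A}\subset\mathbb{Z}^d$ be a finite set whose convex hull $\Delta$ has dimension $d$, and let $w=(w_{\mathbf a}\mid\mathbf a\in\mathcal{A})\in\mathbb{R}_{>0}^{\mathcal{A}}$ be positive weights. A toric patch $X_{\mathcal{A},w}$ (that is, a toric patch of shape $(\mathcal{A},w)$, with image $X_{\mathcal{A},w}$) has rational linear precision if and only if $X_{\mathcal{A},w}$ has maximum likelihood degree $1$.
   Context: For $\mathbf a=(a_1,\dotsc,a_d)\in\mathbb{Z}^d$, $x^{\mathbf a}:=x_1^{a_1}\dotsb x_d^{a_d}$. Let $\mathbb{R}\mathbb{P}^{\mathcal{A}}\subset\mathbb{C}\mathbb{P}^{\mathcal{A}}$ be the real and complex projective spaces with homogeneous coordinates indexed by $\mathcal{A}$. Let $X_{\mathcal{A},w}\subset\mathbb{R}\mathbb{P}^{\mathcal{A}}$ be the closure of the image of $\mathbb{R}_{>0}^d$ under $x\mapsto[w_{\mathbf a}x^{\mathbf a}\mid\mathbf a\in\mathcal{A}]$, and let $Y_{\mathcal{A},w}\subset\mathbb{C}\mathbb{P}^{\mathcal{A}}$ be its Zariski closure, which is the closure of the image of $(\mathbb{C}^\times)^d$ under the same map. In statistics $X_{\mathcal{A},w}$ (regarded inside the probability simplex $\{y\in\mathbb{R}^{\mathcal{A}}_{\ge0}\mid\sum_{\mathbf a}y_{\mathbf a}=1\}$) is the toric, or log-linear, model. The tautological projection is the linear projection $\pi_{\mathcal{A}}\colon\mathbb{C}\mathbb{P}^{\mathcal{A}}\dashrightarrow\mathbb{C}\mathbb{P}^d$,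 $[y_{\mathbf a}]\mapsto\sum_{\mathbf a}y_{\mathbf a}\cdot(1,\mathbf a)$. The maximum likelihood degree of $X_{\mathcal{A},w}$ is the degree of $\pi_{\mathcal{A}}^{-1}$ as an algebraic function; equivalently, it is the number of complex solutions to the critical equations of the likelihood function, which is the degree of the map $\pi_{\mathcal{A}}\colon Y_{\mathcal{A},w}\dashrightarrow\mathbb{C}\mathbb{P}^d$. A (parametric) patch indexed by $\mathcal{A}$ is a collection $\{\beta_{\mathbf a}\mid\mathbf a\in\mathcal{A}\}$ of non-negative real-valued functions (blending functions), smooth where defined, with common domain $\Delta$, that do not vanish simultaneously at any point of $\Delta$. They may be normalized by dividing by $\sum_{\mathbf b}\beta_{\mathbf b}$, so that they sum to $1$. The (normalized) patch has linear precision if for every affine function $\Lambda$ on $\mathbb{R}^d$, $\Lambda(x)=\sum_{\mathbf a}\beta_{\mathbf a}(x)\Lambda(\mathbf a)$ for all $x\in\Delta$. Its tautological map is $\tau\colon\Delta\to\Delta$, $\tau(x)=\sum_{\mathbf a}\beta_{\mathbf a}(x)\mathbf a$ (normalized $\beta_{\mathbf a}$); the patch is proper if $\tau$ is a homeomorphism. The reparametrization by a homeomorphism $\psi\colon\Delta\to\Delta$ is the patch $\{\beta_{\mathbf a}\circ\psi\}$. A proper patch has a unique reparametrization with linear precision (namely by $\psi=\tau^{-1}$). A patch has rational linear precision if it is proper and its reparametrization having linear precision has blending functions that are rational functions (quotients of polynomials). A toric patch of shape $(\mathcal{A},w)$ is any patch such that the image of $\Delta$ under $x\mapsto[\beta_{\mathbf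 a}(x)\mid\mathbf a\in\mathcal{A}]$ equals $X_{\mathcal{A},w}$.
   Formalization: The toric patch is assumed proper: a non-proper toric patch (e.g. A={0,1}, w=1, blending functions (1-2x)^2 and 4x(1-x) on [0,1]) never has rational linear precision although the maximum likelihood degree is 1. *)

theory Defs
  imports "HOL-Analysis.Analysis"
begin

section \<open>Projective spaces with coordinates indexed by a set\<close>

text \<open>
  Coordinate vectors indexed by \<open>I\<close> are functions that vanish outside \<open>I\<close>, and a point of
  the projective space is the punctured line of all its homogeneous coordinate vectors.
\<close>

definition nonzero_vecs :: "'i set \<Rightarrow> ('i \<Rightarrow> 'k::field) set" where
  "nonzero_vecs I = {y. (\<forall>i. i \<notin> I \<longrightarrow> y i = 0) \<and> (\<exists>i\<in>I. y i \<noteq> 0)}"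

definition proj_point :: "('i \<Rightarrow> 'k::field) \<Rightarrow> ('i \<Rightarrow> 'k) set" where
  "proj_point y = {(\<lambda>i. c * y i) |c. c \<noteq> 0}"

definition proj_space :: "'i set \<Rightarrow> ('i \<Rightarrow> 'k::field) set set" where
  "proj_space I = proj_point ` nonzero_vecs I"

text \<open>The quotient of the Euclidean topology, which for finite \<open>I\<close> is the subspace topology
  inherited from the product topology on functions.\<close>

definition proj_topology :: "'i set \<Rightarrow> ('i \<Rightarrow> 'k::real_normed_field) set topology" where
  "proj_topology I = topology (\<lambda>U. U \<subseteq> proj_space I \<and>
     openin (top_of_set (nonzero_vecs I)) {y \<in> nonzero_vecs I. proj_point y \<in> U})"

lemma openin_proj_topology:
  "openin (proj_topology I) U \<longleftrightarrow> U \<subseteq> proj_space I \<and>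
     openin (top_of_set (nonzero_vecs I)) {y \<in> nonzero_vecs I. proj_point y \<in> U}"
proof -
  let ?N = "nonzero_vecs I :: ('a \<Rightarrow> 'b) set"
  let ?P = "\<lambda>U. {y \<in> ?N. proj_point y \<in> U}"
  have "istopology (\<lambda>U. U \<subseteq> proj_space I \<and> openin (top_of_set ?N) (?P U))"
    unfolding istopology_def
  proof (intro conjI allI impI)
    fix S T
    assume "S \<subseteq> proj_space I \<and> openin (top_of_set ?N) (?P S)"
      and "T \<subseteq> proj_space I \<and> openin (top_of_set ?N) (?P T)"
    moreover have "?P (S \<inter> T) = ?P S \<inter> ?P T" by auto
    ultimately show "S \<inter> T \<subseteq> proj_space I" "openin (top_of_set ?N) (?P (S \<inter> T))"
      by (auto simp: openin_Int)
  next
    fix K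
    assume "\<forall>S\<in>K. S \<subseteq> proj_space I \<and> openin (top_of_set ?N) (?P S)"
    moreover have "?P (\<Union>K) = \<Union> (?P ` K)" by auto
    ultimately show "\<Union>K \<subseteq> proj_space I" "openin (top_of_set ?N) (?P (\<Union>K))"
      by (auto intro!: openin_Union)
  qed
  then show ?thesis
    unfolding proj_topology_def by (simp add: topology_inverse')
qed

lemma topspace_proj_topology:
  fixes I :: "'i set"
  shows "topspace (proj_topology I) = (proj_space I :: ('i \<Rightarrow> 'k::real_normed_field) set set)"
proof -
  have "{y \<in> nonzero_vecs I. proj_point y \<in> proj_space I}
      = (nonzero_vecs I :: ('i \<Rightarrow> 'k) set)"
    by (auto simp: proj_space_def)
  then have "openin (proj_topology I) (proj_space I :: ('i \<Rightarrow> 'k) set set)"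
    by (simp add: openin_proj_topology)
  then show ?thesis
    by (auto simp: topspace_def openin_proj_topology)
qed

definition complexify :: "('i \<Rightarrow> real) set \<Rightarrow> ('i \<Rightarrow> complex) set" where
  "complexify p = (\<Union>y\<in>p. proj_point (\<lambda>i. complex_of_real (y i)))"


section \<open>The Zariski topology of complex projective space\<close>

text \<open>Homogeneous polynomials of degree \<open>n\<close> in the coordinates indexed by \<open>I\<close>; \<open>M\<close> is
  the set of exponent vectors.\<close>

definition homogeneous_form :: "'i set \<Rightarrow> nat \<Rightarrow> (('i \<Rightarrow> complex) \<Rightarrow> complex) \<Rightarrow> bool" where
  "homogeneous_form I n F \<longleftrightarrow>
     (\<exists>(M :: ('i \<Rightarrow> nat) set) c. finite M \<and> (\<forall>m\<in>M. (\<Sum>i\<in>I. m i) = n) \<and>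
        F = (\<lambda>y. \<Sum>m\<in>M. c m * (\<Prod>i\<in>I. y i ^ m i)))"

definition zariski_closed :: "'i set \<Rightarrow> ('i \<Rightarrow> complex) set set \<Rightarrow> bool" where
  "zariski_closed I Z \<longleftrightarrow>
     (\<exists>\<F>. (\<forall>F\<in>\<F>. \<exists>n. homogeneous_form I n F) \<and>
        Z = {p \<in> proj_space I. \<forall>F\<in>\<F>. \<forall>y\<in>p. F y = 0})"

definition zariski_open :: "'i set \<Rightarrow> ('i \<Rightarrow> complex) set set \<Rightarrow> bool" where
  "zariski_open I U \<longleftrightarrow> U \<subseteq> proj_space I \<and> zariski_closed I (proj_space I - U)"

text \<open>
  The degree of a rational map from \<open>V\<close> to the projective space with coordinates indexed by
  \<open>J\<close> is the number of points in a general fibre. The map is given by a function \<open>f\<close> whose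
  value lies outside the target at points where the rational map is undefined, so that
  these points belong to no fibre.
\<close>

definition rational_map_degree ::
    "'j set \<Rightarrow> 'p set \<Rightarrow> ('p \<Rightarrow> ('j \<Rightarrow> complex) set) \<Rightarrow> nat \<Rightarrow> bool" where
  "rational_map_degree J V f n \<longleftrightarrow>
     (\<exists>U. zariski_open J U \<and> U \<noteq> {} \<and>
        (\<forall>u\<in>U. finite {p \<in> V. f p = u} \<and> card {p \<in> V. f p = u} = n))"


section \<open>Toric varieties and maximum likelihood degree\<close>

definition real_vec :: "int ^ 'd \<Rightarrow> real ^ 'd" where
  "real_vec a = (\<chi> i. real_of_int (a $ i))"

definition lattice_polytope :: "(int ^ 'd) set \<Rightarrow> (real ^ 'd) set" where
  "lattice_polytope A = convex hull (real_vec ` A)"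

definition monomial_vec ::
    "(int ^ 'd::finite) set \<Rightarrow> (int ^ 'd \<Rightarrow> real) \<Rightarrow> real ^ 'd \<Rightarrow> (int ^ 'd \<Rightarrow> real)" where
  "monomial_vec A w x = (\<lambda>a. if a \<in> A then w a * (\<Prod>i\<in>UNIV. (x $ i) powi (a $ i)) else 0)"

definition toric_X ::
    "(int ^ 'd::finite) set \<Rightarrow> (int ^ 'd \<Rightarrow> real) \<Rightarrow> (int ^ 'd \<Rightarrow> real) set set" where
  "toric_X A w = proj_topology A closure_of
     ((\<lambda>x. proj_point (monomial_vec A w x)) ` {x. \<forall>i. x $ i > 0})"

definition toric_Y ::
    "(int ^ 'd::finite) set \<Rightarrow> (int ^ 'd \<Rightarrow> real) \<Rightarrow> (int ^ 'd \<Rightarrow> complex) set set" where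
  "toric_Y A w = zariski_closed A hull (complexify ` toric_X A w)"

text \<open>The linear map \<open>y \<mapsto> \<Sum> y\<^sub>a (1, a)\<close>; the coordinate indexed by \<open>None\<close> is the
  leading one.\<close>

definition tautological_lin ::
    "(int ^ 'd) set \<Rightarrow> (int ^ 'd \<Rightarrow> complex) \<Rightarrow> ('d option \<Rightarrow> complex)" where
  "tautological_lin A y =
     (\<lambda>j. \<Sum>a\<in>A. y a * (case j of None \<Rightarrow> 1 | Some i \<Rightarrow> of_int (a $ i)))"

text \<open>The image of a punctured line is again a punctured line, or \<open>{0}\<close> on the centre of
  the projection; the latter is not a point of projective space.\<close>

definition tautological_proj ::
    "(int ^ 'd) set \<Rightarrow> (int ^ 'd \<Rightarrow> complex) set \<Rightarrow> ('d option \<Rightarrow> complex) set" where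
  "tautological_proj A p = tautological_lin A ` p"

definition has_ml_degree ::
    "(int ^ 'd::finite) set \<Rightarrow> (int ^ 'd \<Rightarrow> real) \<Rightarrow> nat \<Rightarrow> bool" where
  "has_ml_degree A w n \<longleftrightarrow>
     rational_map_degree UNIV (toric_Y A w) (tautological_proj A) n"


section \<open>Patches\<close>

text \<open>\<open>C\<^sup>k\<close> functions on an open set, via iterated gradients; \<open>GDERIV\<close> is the
  gradient in the full-neighbourhood sense.\<close>

primrec Ck_on :: "nat \<Rightarrow> (real ^ 'd) set \<Rightarrow> (real ^ 'd \<Rightarrow> real) \<Rightarrow> bool" where
  "Ck_on 0 S f \<longleftrightarrow> continuous_on S f"
| "Ck_on (Suc k) S f \<longleftrightarrow>
     (\<exists>g. (\<forall>x\<in>S. GDERIV f x :> g x) \<and> (\<forall>i. Ck_on k S (\<lambda>x. g x $ i)))"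

text \<open>
  Smoothness is required in the interior of the domain only, with continuity up to the
  boundary: already the reparametrization with linear precision of a toric patch need not be
  differentiable at the boundary. For points (0,0), (1,0), (2,0), (0,1) with weights
  1, 2, 1, 1, its blending functions at (s,t) are (2-s-2t)^2 / (4(1-t)),
  s(2-s-2t) / (2(1-t)), s^2 / (4(1-t)) and t.
\<close>

definition patch :: "(int ^ 'd::finite) set \<Rightarrow> (int ^ 'd \<Rightarrow> real ^ 'd \<Rightarrow> real) \<Rightarrow> bool" where
  "patch A \<beta> \<longleftrightarrow>
     (\<forall>a\<in>A. continuous_on (lattice_polytope A) (\<beta> a) \<and>
        (\<forall>k. Ck_on k (interior (lattice_polytope A)) (\<beta> a)) \<and>
        (\<forall>x\<in>lattice_polytope A. \<beta> a x \<ge> 0)) \<and>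
     (\<forall>x\<in>lattice_polytope A. \<exists>a\<in>A. \<beta> a x \<noteq> 0)"

definition normalize_patch ::
    "(int ^ 'd) set \<Rightarrow> (int ^ 'd \<Rightarrow> real ^ 'd \<Rightarrow> real) \<Rightarrow> (int ^ 'd \<Rightarrow> real ^ 'd \<Rightarrow> real)" where
  "normalize_patch A \<beta> = (\<lambda>a x. \<beta> a x / (\<Sum>b\<in>A. \<beta> b x))"

definition linear_precision ::
    "(int ^ 'd::finite) set \<Rightarrow> (int ^ 'd \<Rightarrow> real ^ 'd \<Rightarrow> real) \<Rightarrow> bool" where
  "linear_precision A \<beta> \<longleftrightarrow>
     (\<forall>(l :: real ^ 'd \<Rightarrow> real) c. linear l \<longrightarrow>
        (\<forall>x\<in>lattice_polytope A.
           l x + c = (\<Sum>a\<in>A. normalize_patch A \<beta> a x * (l (real_vec a) + c))))"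

definition tautological_map ::
    "(int ^ 'd::finite) set \<Rightarrow> (int ^ 'd \<Rightarrow> real ^ 'd \<Rightarrow> real) \<Rightarrow> real ^ 'd \<Rightarrow> real ^ 'd" where
  "tautological_map A \<beta> x = (\<Sum>a\<in>A. normalize_patch A \<beta> a x *\<^sub>R real_vec a)"

definition proper_patch ::
    "(int ^ 'd::finite) set \<Rightarrow> (int ^ 'd \<Rightarrow> real ^ 'd \<Rightarrow> real) \<Rightarrow> bool" where
  "proper_patch A \<beta> \<longleftrightarrow>
     (\<exists>\<sigma>. homeomorphism (lattice_polytope A) (lattice_polytope A) (tautological_map A \<beta>) \<sigma>)"

definition reparametrize ::
    "(int ^ 'd \<Rightarrow> real ^ 'd \<Rightarrow> real) \<Rightarrow> (real ^ 'd \<Rightarrow> real ^ 'd) \<Rightarrow>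
     (int ^ 'd \<Rightarrow> real ^ 'd \<Rightarrow> real)" where
  "reparametrize \<beta> \<psi> = (\<lambda>a. \<beta> a \<circ> \<psi>)"

text \<open>The denominator may vanish on the boundary of \<open>S\<close>, as in the example above at
  (0,1); there this definition leaves the value unconstrained. For a continuous \<open>f\<close> on a
  full-dimensional polytope the value is determined by the others.\<close>

definition rational_on :: "(real ^ 'd::finite) set \<Rightarrow> (real ^ 'd \<Rightarrow> real) \<Rightarrow> bool" where
  "rational_on S f \<longleftrightarrow>
     (\<exists>p q. real_polynomial_function p \<and> real_polynomial_function q \<and> (\<exists>x. q x \<noteq> 0) \<and>
        (\<forall>x\<in>S. q x \<noteq> 0 \<longrightarrow> f x = p x / q x))"

definition rational_linear_precision ::
    "(int ^ 'd::finite) set \<Rightarrow> (int ^ 'd \<Rightarrow> real ^ 'd \<Rightarrow> real) \<Rightarrow> bool" where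
  "rational_linear_precision A \<beta> \<longleftrightarrow>
     proper_patch A \<beta> \<and>
     (\<exists>\<psi> \<phi>. homeomorphism (lattice_polytope A) (lattice_polytope A) \<psi> \<phi> \<and>
        linear_precision A (reparametrize \<beta> \<psi>) \<and>
        (\<forall>a\<in>A. rational_on (lattice_polytope A)
           (normalize_patch A (reparametrize \<beta> \<psi>) a)))"

definition toric_patch ::
    "(int ^ 'd::finite) set \<Rightarrow> (int ^ 'd \<Rightarrow> real) \<Rightarrow> (int ^ 'd \<Rightarrow> real ^ 'd \<Rightarrow> real) \<Rightarrow> bool" where
  "toric_patch A w \<beta> \<longleftrightarrow> patch A \<beta> \<and>
     (\<lambda>x. proj_point (\<lambda>a. if a \<in> A then \<beta> a x else 0)) ` lattice_polytope A = toric_X A w"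

end

theory Submission
  imports Defs "HOL-Computational_Algebra.Fundamental_Theorem_Algebra"
begin

text \<open>
  A toric variety is cut out by binomials with coefficients in the field generated by the
  weights, and properness identifies the reparametrization with linear precision as a section
  \<open>g\<close> over the polytope of the tautological projection, with image in the real part \<open>X\<close>.

  If \<open>g = p / q\<close>, then \<open>y\<^sub>a q = p\<close> becomes a homogeneous equation that holds on the positive
  part of the variety, hence on all of \<open>Y\<close>, so that fibres over points with \<open>q \<noteq> 0\<close> have at most
  one point; conversely \<open>p / q\<close> satisfies the equations of \<open>Y\<close> at complex points as well, because
  it does so on an open set of real points.

  If general fibres are single points, take a real point \<open>u\<close> of the polytope whose coordinates
  are algebraically independent over the field \<open>K0\<close> generated by the weights. A coordinate of the
  fibre over \<open>u\<close> outside \<open>K0(u)\<close> would be moved by some homomorphism into the complex numbers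
  that fixes \<open>K0(u)\<close>, which would produce a second point of the fibre. So the fibre is given by
  rational functions at \<open>u\<close>, and by genericity of \<open>u\<close> and uniqueness they agree with \<open>g\<close> everywhere.
\<close>

section \<open>Polynomial functions with restricted coefficients\<close>

text \<open>Homomorphisms are defined on countable subfields and extended one element at a time.
  Countability settles the transcendental case, since all but countably many complex numbers are
  then admissible images; algebraic and transcendental coordinates are thus moved alike. The
  polynomial whose nonvanishing guarantees one-point fibres may have arbitrary complex coefficients,
  over which K0 has no control, so u has to avoid its zeros in addition to being independent over
  K0. Both directions spread the fibre equations by one principle: they persist from a set S to a
  point at which every polynomial over K that vanishes on S also vanishes. In one direction S
  consists of the real interior points and K of all complex numbers; in the other S is the single
  point u and K is K0.\<close>

inductive_set polyfun :: "complex set \<Rightarrow> (('i \<Rightarrow> complex) \<Rightarrow> complex) set"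
  for K :: "complex set" where
  const: "c \<in> K \<Longrightarrow> (\<lambda>_. c) \<in> polyfun K"
| coord: "(\<lambda>x. x i) \<in> polyfun K"
| add: "P \<in> polyfun K \<Longrightarrow> Q \<in> polyfun K \<Longrightarrow> (\<lambda>x. P x + Q x) \<in> polyfun K"
| mult: "P \<in> polyfun K \<Longrightarrow> Q \<in> polyfun K \<Longrightarrow> (\<lambda>x. P x * Q x) \<in> polyfun K"

lemma polyfun_mono: "P \<in> polyfun K \<Longrightarrow> K \<subseteq> L \<Longrightarrow> P \<in> polyfun L"
  by (induction rule: polyfun.induct) (auto intro: polyfun.intros)

lemma polyfun_subst:
  "P \<in> polyfun K \<Longrightarrow> (\<And>i. s i \<in> polyfun K) \<Longrightarrow> (\<lambda>x. P (\<lambda>i. s i x)) \<in> polyfun K"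
  by (induction rule: polyfun.induct) (auto intro: polyfun.intros)

lemma polyfun_sum:
  assumes "0 \<in> K" "finite S" "\<And>s. s \<in> S \<Longrightarrow> f s \<in> polyfun K"
  shows "(\<lambda>x. \<Sum>s\<in>S. f s x) \<in> polyfun K"
  using assms(2,3) by induction (auto intro: polyfun.intros assms(1))

lemma polyfun_prod:
  assumes "1 \<in> K" "finite S" "\<And>s. s \<in> S \<Longrightarrow> f s \<in> polyfun K"
  shows "(\<lambda>x. \<Prod>s\<in>S. f s x) \<in> polyfun K"
  using assms(2,3) by induction (auto intro: polyfun.intros assms(1))

lemma polyfun_power:
  assumes "1 \<in> K" "P \<in> polyfun K"
  shows "(\<lambda>x. P x ^ n) \<in> polyfun K"
  using assms by (induction n) (auto intro: polyfun.intros)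

text \<open>Syntax trees for polynomial expressions, with constants given by their index in an
  enumeration of the coefficients. Trees over countably many variables are countable, and evaluation
  covers \<open>polyfun K\<close>.\<close>

datatype 'i pexp = Const nat | Coord 'i | Add "'i pexp" "'i pexp" | Mult "'i pexp" "'i pexp"

instance pexp :: (countable) countable
  by countable_datatype

primrec pexp_fun :: "complex set \<Rightarrow> 'i pexp \<Rightarrow> ('i \<Rightarrow> complex) \<Rightarrow> complex" where
  "pexp_fun K (Const n) = (\<lambda>_. from_nat_into K n)"
| "pexp_fun K (Coord i) = (\<lambda>x. x i)"
| "pexp_fun K (Add e f) = (\<lambda>x. pexp_fun K e x + pexp_fun K f x)"
| "pexp_fun K (Mult e f) = (\<lambda>x. pexp_fun K e x * pexp_fun K f x)"

lemma countable_polyfun: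
  assumes "countable K"
  shows "countable (polyfun K :: (('i::countable \<Rightarrow> complex) \<Rightarrow> complex) set)"
proof -
  have "\<exists>e. P = pexp_fun K e" if "P \<in> polyfun K" for P :: "('i \<Rightarrow> complex) \<Rightarrow> complex"
    using that
  proof induction
    case (const c)
    then obtain n where n: "from_nat_into K n = c"
      using from_nat_into_surj[OF assms] by metis
    have "pexp_fun K (Const n) = (\<lambda>_. c)" by (simp only: pexp_fun.simps n)
    then show ?case by metis
  next
    case (coord i)
    have "pexp_fun K (Coord i) = (\<lambda>x. x i)" by (simp only: pexp_fun.simps)
    then show ?case by metis
  next
    case (add P Q)
    then obtain e f where "P = pexp_fun K e" "Q = pexp_fun K f" by blast
    then show ?case by (intro exI[of _ "Add e f"]) simp
  next
    case (mult P Q)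
    then obtain e f where "P = pexp_fun K e" "Q = pexp_fun K f" by blast
    then show ?case by (intro exI[of _ "Mult e f"]) simp
  qed
  then have "polyfun K \<subseteq> range (pexp_fun K :: 'i pexp \<Rightarrow> _)" by blast
  then show ?thesis by (rule countable_subset) simp
qed

text \<open>Restriction to a line reduces the vanishing of a polynomial in several variables to the
  finiteness of the roots of a univariate one.\<close>

lemma polyfun_line:
  assumes "P \<in> polyfun K"
  shows "\<exists>p. \<forall>t. P (\<lambda>i. v i + t * w i) = poly p t"
  using assms
proof induction
  case (const c)
  show ?case by (rule exI[of _ "[:c:]"]) simp
next
  case (coord i)
  show ?case by (rule exI[of _ "[:v i, w i:]"]) simp
next
  case (add P Q)
  then show ?case by (metis poly_add)
next
  case (mult P Q)
  then show ?case by (metis poly_mult)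
qed

section \<open>Complex polynomials at real points\<close>

definition cvec :: "real ^ 'd \<Rightarrow> 'd \<Rightarrow> complex" where
  "cvec x = (\<lambda>i. complex_of_real (x $ i))"

lemma continuous_on_polyfun_cvec:
  fixes P :: "('d::finite \<Rightarrow> complex) \<Rightarrow> complex"
  assumes "P \<in> polyfun K"
  shows "continuous_on S (\<lambda>x. P (cvec x))"
  using assms
proof induction
  case (coord i)
  show ?case unfolding cvec_def by (intro continuous_intros)
qed (simp_all add: continuous_on_add continuous_on_mult)

lemma poly_eq_0_if_vanishes_near_0:
  fixes p :: "complex poly"
  assumes "e > 0" "\<And>t::real. 0 < t \<Longrightarrow> t < e \<Longrightarrow> poly p (of_real t) = 0"
  shows "p = 0"
proof (rule ccontr)
  assume "p \<noteq> 0"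
  then have "finite {z. poly p z = 0}" by (rule poly_roots_finite)
  moreover have "of_real ` {0<..<e} \<subseteq> {z. poly p z = 0}" using assms by auto
  ultimately have "finite (complex_of_real ` {0<..<e})" by (rule rev_finite_subset)
  then have "finite {0<..<e}" by (rule finite_imageD) (auto simp: inj_on_def)
  then show False using assms(1) by (simp add: infinite_Ioo)
qed

text \<open>Two lines suffice. A line from a point of W reaches every real point, since its initial
  segment stays in W. Then the real line through Re z in direction Im z carries infinitely many
  zeros, and its complex parameter may be set to the imaginary unit, which gives z.\<close>

lemma polyfun_eq_0_if_vanishes_on_open:
  fixes P :: "('d::finite \<Rightarrow> complex) \<Rightarrow> complex"
  assumes P: "P \<in> polyfun K" and W: "open W" "W \<noteq> {}" "\<And>x. x \<in> W \<Longrightarrow> P (cvec x) = 0"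
  shows "P z = 0"
proof -
  obtain x0 where x0: "x0 \<in> W" using W by blast
  have real: "P (cvec x) = 0" for x
  proof -
    obtain p where p: "\<And>t. P (\<lambda>i. cvec x0 i + t * cvec (x - x0) i) = poly p t"
      using polyfun_line[OF P] by blast
    have "((\<lambda>t::real. x0 + t *\<^sub>R (x - x0)) \<longlongrightarrow> x0 + 0 *\<^sub>R (x - x0)) (at_right 0)"
      by (intro tendsto_intros)
    then have "\<forall>\<^sub>F t in at_right 0. x0 + t *\<^sub>R (x - x0) \<in> W"
      using W(1) x0 by (auto dest: topological_tendstoD)
    then obtain e where e: "e > 0" "\<And>t. 0 < t \<Longrightarrow> t < e \<Longrightarrow> x0 + t *\<^sub>R (x - x0) \<in> W"
      by (auto simp: eventually_at_right_field)
    have line: "(\<lambda>i. cvec x0 i + of_real t * cvec (x - x0) i) = cvec (x0 + t *\<^sub>R (x - x0))" for t :: real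
      by (auto simp: cvec_def)
    have "p = 0"
      by (rule poly_eq_0_if_vanishes_near_0[OF e(1)]) (metis W(3) e(2) line p)
    then have "P (\<lambda>i. cvec x0 i + of_real 1 * cvec (x - x0) i) = 0" by (simp only: p poly_0)
    then show ?thesis unfolding line by simp
  qed
  define x y where "x = (\<chi> i. Re (z i))" and "y = (\<chi> i. Im (z i))"
  obtain p where p: "\<And>t. P (\<lambda>i. cvec x i + t * cvec y i) = poly p t"
    using polyfun_line[OF P] by blast
  have line: "(\<lambda>i. cvec x i + of_real t * cvec y i) = cvec (x + t *\<^sub>R y)" for t :: real
    by (auto simp: cvec_def)
  have "p = 0"
    by (rule poly_eq_0_if_vanishes_near_0[OF zero_less_one]) (metis line p real)
  then have "P (\<lambda>i. cvec x i + \<i> * cvec y i) = 0" by (simp only: p poly_0)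
  moreover have "(\<lambda>i. cvec x i + \<i> * cvec y i) = z"
    by (auto simp: cvec_def x_def y_def complex_eq_iff)
  ultimately show ?thesis by simp
qed

text \<open>Baire category: the nonvanishing sets are open, and dense because a nonzero polynomial
  cannot vanish on an open set of real points. Applied to all nonzero polynomials over a countable
  field, this yields a real point with algebraically independent coordinates.\<close>

lemma countable_polyfun_common_nonzero:
  fixes \<P> :: "(('d::finite \<Rightarrow> complex) \<Rightarrow> complex) set"
  assumes "countable \<P>" "\<P> \<subseteq> polyfun UNIV" "\<And>P. P \<in> \<P> \<Longrightarrow> \<exists>z. P z \<noteq> 0"
    and W: "open W" "W \<noteq> {}"
  shows "\<exists>x\<in>W. \<forall>P\<in>\<P>. P (cvec x) \<noteq> 0"
proof -
  define \<G> where "\<G> = (\<lambda>P. {x :: real ^ 'd. P (cvec x) \<noteq> 0}) ` \<P>"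
  have "UNIV \<subseteq> closure (\<Inter>\<G>)"
  proof (rule Baire)
    show "countable \<G>" using assms(1) by (simp add: \<G>_def)
    fix T assume "T \<in> \<G>"
    then obtain P where P: "P \<in> \<P>" and T: "T = {x. P (cvec x) \<noteq> 0}" by (auto simp: \<G>_def)
    have pf: "P \<in> polyfun UNIV" using P assms(2) by blast
    have "open ((\<lambda>x. P (cvec x)) -` (- {0}))"
      by (intro open_vimage continuous_on_polyfun_cvec[OF pf]) auto
    then have "open T" by (simp add: T vimage_def)
    moreover have "x \<in> closure T" for x
    proof (rule ccontr)
      assume "x \<notin> closure T"
      then have "- closure T \<noteq> {}" by blast
      moreover have "P (cvec y) = 0" if "y \<in> - closure T" for y
      proof -
        have "y \<notin> T" using that closure_subset[of T] by auto
        then show ?thesis by (simp add: T)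
      qed
      ultimately have "P z = 0" for z
        using polyfun_eq_0_if_vanishes_on_open[OF pf, of "- closure T"] by blast
      then show False using assms(3)[OF P] by blast
    qed
    ultimately show "openin (top_of_set UNIV) T \<and> UNIV \<subseteq> closure T" by auto
  qed auto
  then have "W \<inter> \<Inter>\<G> \<noteq> {}"
    using W open_Int_closure_eq_empty[of W "\<Inter>\<G>"] by auto
  then show ?thesis by (auto simp: \<G>_def)
qed

section \<open>Homomorphisms from countable fields of complex numbers\<close>

definition complex_subfield :: "complex set \<Rightarrow> bool" where
  "complex_subfield F \<longleftrightarrow> 1 \<in> F \<and> (\<forall>x\<in>F. \<forall>y\<in>F. x - y \<in> F \<and> x * y \<in> F) \<and>
     (\<forall>x\<in>F. inverse x \<in> F)"

text \<open>A total function of which only the values on F matter, so that an extension is a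
  function that agrees on F.\<close>

definition field_hom :: "complex set \<Rightarrow> (complex \<Rightarrow> complex) \<Rightarrow> bool" where
  "field_hom F \<sigma> \<longleftrightarrow> \<sigma> 1 = 1 \<and>
     (\<forall>x\<in>F. \<forall>y\<in>F. \<sigma> (x + y) = \<sigma> x + \<sigma> y \<and> \<sigma> (x * y) = \<sigma> x * \<sigma> y)"

definition polys_over :: "complex set \<Rightarrow> complex poly set" where
  "polys_over F = {p. \<forall>i. coeff p i \<in> F}"

lemma countable_polys_over:
  assumes "countable F"
  shows "countable (polys_over F)"
proof -
  have "countable (lists F)" using assms by (rule countable_lists)
  moreover have "polys_over F \<subseteq> Poly ` lists F"
  proof
    fix p assume "p \<in> polys_over F"
    then have "coeffs p \<in> lists F" by (auto simp: polys_over_def coeffs_def)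
    then show "p \<in> Poly ` lists F" by (metis Poly_coeffs imageI)
  qed
  ultimately show ?thesis by (meson countable_image countable_subset)
qed

context
  fixes F assumes F: "complex_subfield F"
begin

lemma subfield_one: "1 \<in> F" and subfield_diff: "x \<in> F \<Longrightarrow> y \<in> F \<Longrightarrow> x - y \<in> F"
  and subfield_mult: "x \<in> F \<Longrightarrow> y \<in> F \<Longrightarrow> x * y \<in> F"
  and subfield_inverse: "x \<in> F \<Longrightarrow> inverse x \<in> F"
  using F by (auto simp: complex_subfield_def)

lemma subfield_zero: "0 \<in> F"
  using subfield_diff[OF subfield_one subfield_one] by simp

lemma subfield_add: "x \<in> F \<Longrightarrow> y \<in> F \<Longrightarrow> x + y \<in> F"
  using subfield_diff[of x "0 - y"] subfield_diff[of 0 y] subfield_zero by simp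

lemma subfield_divide: "x \<in> F \<Longrightarrow> y \<in> F \<Longrightarrow> x / y \<in> F"
  by (simp add: divide_inverse subfield_mult subfield_inverse)

lemma subfield_of_nat: "of_nat n \<in> F"
  by (induction n) (auto intro: subfield_zero subfield_add subfield_one)

lemma subfield_of_int: "of_int n \<in> F"
proof (cases "n \<ge> 0")
  case True
  then show ?thesis using subfield_of_nat[of "nat n"] by simp
next
  case False
  then show ?thesis
    using subfield_diff[OF subfield_zero subfield_of_nat[of "nat (- n)"]] by simp
qed

lemma subfield_sum: "finite S \<Longrightarrow> (\<And>s. s \<in> S \<Longrightarrow> f s \<in> F) \<Longrightarrow> sum f S \<in> F"
  by (induction rule: finite_induct) (auto intro: subfield_zero subfield_add)

lemma subfield_power: "x \<in> F \<Longrightarrow> x ^ n \<in> F"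
  by (induction n) (auto intro: subfield_one subfield_mult)

lemma subfield_prod: "finite S \<Longrightarrow> (\<And>s. s \<in> S \<Longrightarrow> f s \<in> F) \<Longrightarrow> prod f S \<in> F"
  by (induction rule: finite_induct) (auto intro: subfield_one subfield_mult)

lemma polys_over_0: "0 \<in> polys_over F"
  by (simp add: polys_over_def subfield_zero)

lemma polys_over_const: "c \<in> F \<Longrightarrow> [:c:] \<in> polys_over F"
  by (auto simp: polys_over_def coeff_pCons subfield_zero split: nat.split)

lemma polys_over_X: "[:0, 1:] \<in> polys_over F"
  by (auto simp: polys_over_def coeff_pCons subfield_zero subfield_one split: nat.split)

lemma polys_over_add: "p \<in> polys_over F \<Longrightarrow> q \<in> polys_over F \<Longrightarrow> p + q \<in> polys_over F"
  by (simp add: polys_over_def subfield_add)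

lemma polys_over_diff: "p \<in> polys_over F \<Longrightarrow> q \<in> polys_over F \<Longrightarrow> p - q \<in> polys_over F"
  by (simp add: polys_over_def subfield_diff)

lemma polys_over_mult: "p \<in> polys_over F \<Longrightarrow> q \<in> polys_over F \<Longrightarrow> p * q \<in> polys_over F"
  by (auto simp: polys_over_def coeff_mult intro!: subfield_sum subfield_mult)

lemma polys_over_monom: "c \<in> F \<Longrightarrow> monom c n \<in> polys_over F"
  by (auto simp: polys_over_def subfield_zero)

lemma polys_over_pderiv: "p \<in> polys_over F \<Longrightarrow> pderiv p \<in> polys_over F"
  using subfield_of_nat[of "Suc _"]
  by (auto simp: polys_over_def coeff_pderiv simp del: of_nat_Suc intro!: subfield_mult)

text \<open>Euclidean division with control of the coefficients: cancelling the leading term of p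
  uses only a quotient of two elements of F.\<close>

lemma polys_over_division:
  assumes "p \<in> polys_over F" "m \<in> polys_over F" "m \<noteq> 0"
  shows "\<exists>q\<in>polys_over F. \<exists>r\<in>polys_over F. p = q * m + r \<and> (r = 0 \<or> degree r < degree m)"
  using assms(1)
proof (induction "degree p" arbitrary: p rule: less_induct)
  case less
  show ?case
  proof (cases "p = 0 \<or> degree p < degree m")
    case True
    then show ?thesis
      using less.prems by (intro bexI[of _ 0] bexI[of _ p]) (auto simp: polys_over_0)
  next
    case False
    define c where "c = lead_coeff p / lead_coeff m"
    define s where "s = monom c (degree p - degree m)"
    have "c \<in> F" using less.prems assms by (auto simp: c_def polys_over_def intro: subfield_divide)
    then have s: "s \<in> polys_over F" by (simp add: s_def polys_over_monom)
    define p' where "p' = p - s * m"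
    have p': "p' \<in> polys_over F"
      using less.prems s assms by (simp add: p'_def polys_over_diff polys_over_mult)
    have "c \<noteq> 0" using False assms by (simp add: c_def)
    have "degree (s * m) = degree p"
      using False assms \<open>c \<noteq> 0\<close> by (simp add: s_def degree_mult_eq degree_monom_eq)
    then have "degree p' \<le> degree p" by (simp add: p'_def degree_diff_le)
    moreover have "coeff p' (degree p) = 0"
    proof -
      have "lead_coeff s = c" using \<open>c \<noteq> 0\<close> by (simp add: s_def degree_monom_eq)
      then have "coeff (s * m) (degree p) = c * lead_coeff m"
        using \<open>degree (s * m) = degree p\<close> lead_coeff_mult[of s m] by simp
      then show ?thesis using assms(3) by (simp add: p'_def c_def)
    qed
    ultimately have "p' = 0 \<or> degree p' < degree p" by (rule eq_zero_or_degree_less)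
    then obtain q r where qr: "q \<in> polys_over F" "r \<in> polys_over F" "p' = q * m + r"
      "r = 0 \<or> degree r < degree m"
      using less.hyps[of p'] p' polys_over_0 by (metis add_0 mult_zero_left)
    then have "p = (q + s) * m + r" by (simp add: p'_def algebra_simps)
    then show ?thesis using qr s polys_over_add by blast
  qed
qed

section \<open>Extending and moving homomorphisms\<close>

context
  fixes \<sigma> assumes \<sigma>: "field_hom F \<sigma>"
begin

lemma hom_one: "\<sigma> 1 = 1" and hom_add: "x \<in> F \<Longrightarrow> y \<in> F \<Longrightarrow> \<sigma> (x + y) = \<sigma> x + \<sigma> y"
  and hom_mult: "x \<in> F \<Longrightarrow> y \<in> F \<Longrightarrow> \<sigma> (x * y) = \<sigma> x * \<sigma> y"
  using \<sigma> by (auto simp: field_hom_def)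

lemma hom_zero: "\<sigma> 0 = 0"
  using hom_add[OF subfield_zero subfield_zero] by simp

lemma hom_diff: "x \<in> F \<Longrightarrow> y \<in> F \<Longrightarrow> \<sigma> (x - y) = \<sigma> x - \<sigma> y"
  using hom_add[of "x - y" y] subfield_diff by (simp add: algebra_simps)

lemma hom_eq_0_iff: "x \<in> F \<Longrightarrow> \<sigma> x = 0 \<longleftrightarrow> x = 0"
  using hom_mult[of x "inverse x"] hom_one hom_zero subfield_inverse
  by (cases "x = 0") auto

lemma hom_sum: "finite S \<Longrightarrow> (\<And>s. s \<in> S \<Longrightarrow> f s \<in> F) \<Longrightarrow> \<sigma> (sum f S) = (\<Sum>s\<in>S. \<sigma> (f s))"
  by (induction rule: finite_induct) (auto simp: hom_zero hom_add subfield_sum)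

lemma hom_power: "x \<in> F \<Longrightarrow> \<sigma> (x ^ n) = \<sigma> x ^ n"
  by (induction n) (auto simp: hom_one hom_mult subfield_power)

lemma hom_prod: "finite S \<Longrightarrow> (\<And>s. s \<in> S \<Longrightarrow> f s \<in> F) \<Longrightarrow> \<sigma> (prod f S) = (\<Prod>s\<in>S. \<sigma> (f s))"
  by (induction rule: finite_induct) (auto simp: hom_one hom_mult subfield_prod)

lemma hom_divide: "x \<in> F \<Longrightarrow> y \<in> F \<Longrightarrow> \<sigma> (x / y) = \<sigma> x / \<sigma> y"
  using hom_mult[of "x / y" y] subfield_divide[of x y] hom_eq_0_iff[of y]
  by (cases "y = 0") (auto simp: hom_zero field_simps)

lemma map_poly_hom_add:
  "p \<in> polys_over F \<Longrightarrow> q \<in> polys_over F \<Longrightarrow> map_poly \<sigma> (p + q) = map_poly \<sigma> p + map_poly \<sigma> q"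
  by (rule poly_eqI) (simp add: coeff_map_poly hom_zero polys_over_def hom_add)

lemma map_poly_hom_diff:
  "p \<in> polys_over F \<Longrightarrow> q \<in> polys_over F \<Longrightarrow> map_poly \<sigma> (p - q) = map_poly \<sigma> p - map_poly \<sigma> q"
  by (rule poly_eqI) (simp add: coeff_map_poly hom_zero polys_over_def hom_diff)

lemma map_poly_hom_mult:
  "p \<in> polys_over F \<Longrightarrow> q \<in> polys_over F \<Longrightarrow> map_poly \<sigma> (p * q) = map_poly \<sigma> p * map_poly \<sigma> q"
  by (rule poly_eqI)
    (simp add: coeff_map_poly hom_zero coeff_mult polys_over_def hom_sum hom_mult subfield_mult)

lemma map_poly_hom_eq_0_iff: "p \<in> polys_over F \<Longrightarrow> map_poly \<sigma> p = 0 \<longleftrightarrow> p = 0"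
  by (simp add: poly_eq_iff coeff_map_poly hom_zero polys_over_def hom_eq_0_iff)

lemma degree_map_poly_hom: "p \<in> polys_over F \<Longrightarrow> degree (map_poly \<sigma> p) = degree p"
  by (simp add: degree_def coeff_map_poly hom_zero polys_over_def hom_eq_0_iff)

text \<open>The extension sends p(\<beta>) / q(\<beta>) to the quotient of the transported
  polynomials at \<gamma>. Of the equivalence \<open>\<gamma>\<close>, one implication makes the
  value independent of the representation and the other keeps the new denominators nonzero.\<close>

lemma hom_extend_to:
  assumes \<gamma>: "\<And>p. p \<in> polys_over F \<Longrightarrow> poly p \<beta> = 0 \<longleftrightarrow> poly (map_poly \<sigma> p) \<gamma> = 0"
    and cF: "countable F"
  shows "\<exists>F' \<sigma>'. complex_subfield F' \<and> countable F' \<and> F \<subseteq> F' \<and> \<beta> \<in> F' \<and> field_hom F' \<sigma>' \<and>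
    (\<forall>x\<in>F. \<sigma>' x = \<sigma> x) \<and> \<sigma>' \<beta> = \<gamma>"
proof -
  let ?P = "polys_over F"
  define F' where "F' = {poly p \<beta> / poly q \<beta> |p q. p \<in> ?P \<and> q \<in> ?P \<and> poly q \<beta> \<noteq> 0}"
  define g where "g p = poly (map_poly \<sigma> p) \<gamma>" for p
  have g_mult: "g (p * q) = g p * g q" and g_add: "g (p + q) = g p + g q"
    and g_diff: "g (p - q) = g p - g q"
    if "p \<in> ?P" "q \<in> ?P" for p q
    using that by (simp_all add: g_def map_poly_hom_mult map_poly_hom_add map_poly_hom_diff)
  have g0: "g p = 0 \<longleftrightarrow> poly p \<beta> = 0" if "p \<in> ?P" for p
    using \<gamma>[OF that] by (simp add: g_def)
  define \<sigma>' where "\<sigma>' z = (THE v. \<exists>p\<in>?P. \<exists>q\<in>?P. poly q \<beta> \<noteq> 0 \<and> z = poly p \<beta> / poly q \<beta> \<and>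
     v = g p / g q)" for z
  have \<sigma>': "\<sigma>' (poly p \<beta> / poly q \<beta>) = g p / g q"
    if pq: "p \<in> ?P" "q \<in> ?P" "poly q \<beta> \<noteq> 0" for p q
    unfolding \<sigma>'_def
  proof (rule the_equality)
    show "\<exists>p'\<in>?P. \<exists>q'\<in>?P. poly q' \<beta> \<noteq> 0 \<and> poly p \<beta> / poly q \<beta> = poly p' \<beta> / poly q' \<beta> \<and>
      g p / g q = g p' / g q'" using pq by blast
  next
    fix v assume "\<exists>p'\<in>?P. \<exists>q'\<in>?P. poly q' \<beta> \<noteq> 0 \<and>
      poly p \<beta> / poly q \<beta> = poly p' \<beta> / poly q' \<beta> \<and> v = g p' / g q'"
    then obtain p' q' where pq': "p' \<in> ?P" "q' \<in> ?P" "poly q' \<beta> \<noteq> 0"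
      and eq: "poly p \<beta> / poly q \<beta> = poly p' \<beta> / poly q' \<beta>" and v: "v = g p' / g q'" by blast
    have "poly (p * q' - p' * q) \<beta> = 0" using eq pq(3) pq'(3) by (simp add: field_simps)
    moreover have "p * q' - p' * q \<in> ?P" using pq pq' by (intro polys_over_mult polys_over_diff)
    ultimately have "g (p * q' - p' * q) = 0" using g0 by simp
    then have "g p * g q' = g p' * g q"
      using pq pq' by (simp add: g_diff g_mult polys_over_mult)
    moreover have "g q \<noteq> 0" "g q' \<noteq> 0" using pq pq' g0 by simp_all
    ultimately show "v = g p / g q" by (simp add: v field_simps)
  qed
  have F'I: "poly p \<beta> / poly q \<beta> \<in> F'" if "p \<in> ?P" "q \<in> ?P" for p q
  proof (cases "poly q \<beta> = 0")
    case True
    have "poly 0 \<beta> / poly [:1:] \<beta> \<in> F'"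
      unfolding F'_def
      by (rule CollectI, rule exI[of _ 0], rule exI[of _ "[:1:]"])
        (simp add: polys_over_0 polys_over_const subfield_one)
    then show ?thesis using True by simp
  qed (use that in \<open>auto simp: F'_def\<close>)
  have F'E: "\<exists>p\<in>?P. \<exists>q\<in>?P. z = poly p \<beta> / poly q \<beta> \<and> poly q \<beta> \<noteq> 0" if "z \<in> F'" for z
    using that by (auto simp: F'_def)
  have one: "[:1:] \<in> ?P" by (rule polys_over_const[OF subfield_one])
  have g_one: "g [:1:] = 1"
    using hom_one hom_zero by (simp add: g_def map_poly_pCons)
  have sub: "complex_subfield F'"
    unfolding complex_subfield_def
  proof (intro conjI ballI)
    show "1 \<in> F'" using F'I[OF one one] by simp
    fix x assume "x \<in> F'"
    then obtain p q where x: "p \<in> ?P" "q \<in> ?P" "x = poly p \<beta> / poly q \<beta>" "poly q \<beta> \<noteq> 0"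
      using F'E by metis
    show "inverse x \<in> F'" using F'I[OF x(2,1)] by (simp add: x)
    fix y assume "y \<in> F'"
    then obtain r s where y: "r \<in> ?P" "s \<in> ?P" "y = poly r \<beta> / poly s \<beta>" "poly s \<beta> \<noteq> 0"
      using F'E by metis
    have "x - y = poly (p * s - r * q) \<beta> / poly (q * s) \<beta>"
      unfolding x(3) y(3) using x(4) y(4) by (simp add: field_simps)
    then show "x - y \<in> F'"
      using F'I[of "p * s - r * q" "q * s"] x y by (simp add: polys_over_diff polys_over_mult)
    have "x * y = poly (p * r) \<beta> / poly (q * s) \<beta>" using x y by simp
    then show "x * y \<in> F'"
      using F'I[of "p * r" "q * s"] x y by (simp add: polys_over_mult)
  qed
  have "countable ?P" using cF by (rule countable_polys_over)
  moreover have "F' \<subseteq> (\<lambda>(p, q). poly p \<beta> / poly q \<beta>) ` (?P \<times> ?P)"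
    by (force simp: F'_def)
  ultimately have cF': "countable F'"
    by (meson countable_SIGMA countable_image countable_subset)
  have hom: "field_hom F' \<sigma>'"
    unfolding field_hom_def
  proof (intro conjI ballI)
    show "\<sigma>' 1 = 1" using \<sigma>'[OF one one] g_one by simp
    fix x y assume "x \<in> F'" "y \<in> F'"
    then obtain p q r s where x: "p \<in> ?P" "q \<in> ?P" "x = poly p \<beta> / poly q \<beta>" "poly q \<beta> \<noteq> 0"
      and y: "r \<in> ?P" "s \<in> ?P" "y = poly r \<beta> / poly s \<beta>" "poly s \<beta> \<noteq> 0"
      using F'E by metis
    have gn: "g q \<noteq> 0" "g s \<noteq> 0" using x y g0 by simp_all
    have qs: "q * s \<in> ?P" "poly (q * s) \<beta> \<noteq> 0" using x y by (auto simp: polys_over_mult)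
    have "x + y = poly (p * s + r * q) \<beta> / poly (q * s) \<beta>"
      unfolding x(3) y(3) using x(4) y(4) by (simp add: field_simps)
    then have "\<sigma>' (x + y) = g (p * s + r * q) / g (q * s)"
      by (simp only: \<sigma>'[OF polys_over_add[OF polys_over_mult[OF x(1) y(2)] polys_over_mult[OF y(1) x(2)]] qs])
    then show "\<sigma>' (x + y) = \<sigma>' x + \<sigma>' y"
      unfolding x(3) y(3) \<sigma>'[OF x(1,2,4)] \<sigma>'[OF y(1,2,4)]
      using x y gn by (simp add: g_add g_mult polys_over_mult field_simps)
    have "x * y = poly (p * r) \<beta> / poly (q * s) \<beta>" using x y by simp
    then have "\<sigma>' (x * y) = g (p * r) / g (q * s)"
      by (simp only: \<sigma>'[OF polys_over_mult[OF x(1) y(1)] qs])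
    then show "\<sigma>' (x * y) = \<sigma>' x * \<sigma>' y"
      unfolding x(3) y(3) \<sigma>'[OF x(1,2,4)] \<sigma>'[OF y(1,2,4)] using x y by (simp add: g_mult)
  qed
  have F: "c \<in> F' \<and> \<sigma>' c = \<sigma> c" if "c \<in> F" for c
    using F'I[OF polys_over_const[OF that] one] \<sigma>'[OF polys_over_const[OF that] one] g_one
      hom_zero by (cases "c = 0") (auto simp: g_def map_poly_pCons)
  have "\<beta> \<in> F' \<and> \<sigma>' \<beta> = \<gamma>"
    using F'I[OF polys_over_X one] \<sigma>'[OF polys_over_X one] g_one hom_zero hom_one
    by (auto simp: g_def map_poly_pCons)
  then show ?thesis using sub cF' hom F by blast
qed

text \<open>One implication is division by m. For the other, let m' have least degree among the
  nonzero polynomials over F whose transport vanishes at \<gamma>; it divides all the others, in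
  particular m = k m'. If m' did not vanish at \<beta>, then k would, so minimality of m would make
  m' constant, although its transport is nonzero and has a root. Hence m' vanishes at \<beta>, and
  so do its multiples.\<close>

lemma hom_conjugate_algebraic:
  assumes m: "m \<in> polys_over F" "m \<noteq> 0" "poly m \<beta> = 0"
    and min: "\<And>p. p \<in> polys_over F \<Longrightarrow> p \<noteq> 0 \<Longrightarrow> poly p \<beta> = 0 \<Longrightarrow> degree m \<le> degree p"
    and \<gamma>: "poly (map_poly \<sigma> m) \<gamma> = 0" and p: "p \<in> polys_over F"
  shows "poly p \<beta> = 0 \<longleftrightarrow> poly (map_poly \<sigma> p) \<gamma> = 0"
proof
  assume "poly p \<beta> = 0"
  obtain q r where qr: "q \<in> polys_over F" "r \<in> polys_over F" "p = q * m + r"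
      "r = 0 \<or> degree r < degree m"
    using polys_over_division[OF p m(1,2)] by blast
  have "poly r \<beta> = 0" using qr(3) \<open>poly p \<beta> = 0\<close> m by simp
  then have "r = 0" using qr min[of r] by linarith
  then show "poly (map_poly \<sigma> p) \<gamma> = 0" using qr m \<gamma> by (simp add: map_poly_hom_mult)
next
  assume pg: "poly (map_poly \<sigma> p) \<gamma> = 0"
  define S where "S n \<longleftrightarrow> (\<exists>p\<in>polys_over F. p \<noteq> 0 \<and> poly (map_poly \<sigma> p) \<gamma> = 0 \<and> degree p = n)" for n
  have "S (LEAST n. S n)" by (rule LeastI[of S "degree m"]) (use m \<gamma> S_def in blast)
  then obtain m' where m': "m' \<in> polys_over F" "m' \<noteq> 0" "poly (map_poly \<sigma> m') \<gamma> = 0"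
    "degree m' = (LEAST n. S n)" unfolding S_def by blast
  have min': "degree m' \<le> degree q"
    if "q \<in> polys_over F" "q \<noteq> 0" "poly (map_poly \<sigma> q) \<gamma> = 0" for q
    unfolding m'(4) by (rule Least_le) (use that S_def in blast)
  have gen: "\<exists>k\<in>polys_over F. q = k * m'"
    if q: "q \<in> polys_over F" "poly (map_poly \<sigma> q) \<gamma> = 0" for q
  proof -
    obtain k r where kr: "k \<in> polys_over F" "r \<in> polys_over F" "q = k * m' + r"
      "r = 0 \<or> degree r < degree m'"
      using polys_over_division[OF q(1) m'(1,2)] by blast
    have "poly (map_poly \<sigma> r) \<gamma> = 0"
      using q kr m' by (simp add: map_poly_hom_add map_poly_hom_mult polys_over_mult)
    then have "r = 0" using kr min'[of r] by linarith
    then show ?thesis using kr by auto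
  qed
  obtain k where k: "k \<in> polys_over F" "m = k * m'" using gen[OF m(1) \<gamma>] by blast
  have "poly m' \<beta> = 0"
  proof (rule ccontr)
    assume "poly m' \<beta> \<noteq> 0"
    then have "poly k \<beta> = 0" using m(3) k by simp
    moreover have "k \<noteq> 0" using m(2) k by auto
    ultimately have "degree m \<le> degree k" using min k by blast
    then have "degree m' = 0" using k \<open>k \<noteq> 0\<close> m'(2) by (simp add: degree_mult_eq)
    then have "degree (map_poly \<sigma> m') = 0" using degree_map_poly_hom m' by simp
    then obtain c where "map_poly \<sigma> m' = [:c:]" by (rule degree_eq_zeroE)
    then have "map_poly \<sigma> m' = 0" using m'(3) by simp
    then show False using m' map_poly_hom_eq_0_iff by blast
  qed
  then show "poly p \<beta> = 0" using gen[OF p pg] by auto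
qed

text \<open>Transport preserves nonzero polynomials, and the countably many of them have countably
  many roots together. Any \<gamma> outside these roots is as transcendental over the image of F as
  \<beta> is over F, and \<beta> itself can be avoided too.\<close>

lemma hom_conjugate_transcendental:
  assumes cF: "countable F" and tr: "\<And>p. p \<in> polys_over F \<Longrightarrow> poly p \<beta> = 0 \<Longrightarrow> p = 0"
  shows "\<exists>\<gamma>. \<gamma> \<noteq> \<beta> \<and> (\<forall>p\<in>polys_over F. poly p \<beta> = 0 \<longleftrightarrow> poly (map_poly \<sigma> p) \<gamma> = 0)"
proof -
  have "countable (polys_over F)" using cF by (rule countable_polys_over)
  then have "countable (insert \<beta> (\<Union>p\<in>polys_over F - {0}. {z. poly (map_poly \<sigma> p) z = 0}))"
    using poly_roots_finite map_poly_hom_eq_0_iff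
    by (intro countable_insert countable_UN) (auto intro: countable_finite)
  then obtain \<gamma> where "\<gamma> \<notin> insert \<beta> (\<Union>p\<in>polys_over F - {0}. {z. poly (map_poly \<sigma> p) z = 0})"
    using uncountable_UNIV_complex by (metis UNIV_eq_I)
  then show ?thesis using tr by (intro exI[of _ \<gamma>]) force
qed

end

lemma minimal_annihilating_poly:
  assumes "p \<in> polys_over F" "poly p \<beta> = 0" "p \<noteq> 0"
  shows "\<exists>m\<in>polys_over F. m \<noteq> 0 \<and> poly m \<beta> = 0 \<and> degree m \<noteq> 0 \<and>
    (\<forall>p\<in>polys_over F. p \<noteq> 0 \<longrightarrow> poly p \<beta> = 0 \<longrightarrow> degree m \<le> degree p)"
proof -
  define S where "S n \<longleftrightarrow> (\<exists>p\<in>polys_over F. p \<noteq> 0 \<and> poly p \<beta> = 0 \<and> degree p = n)" for n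
  have "S (LEAST n. S n)" by (rule LeastI[of S "degree p"]) (use assms S_def in blast)
  then obtain m where m: "m \<in> polys_over F" "m \<noteq> 0" "poly m \<beta> = 0"
    "degree m = (LEAST n. S n)" unfolding S_def by blast
  have "degree m \<le> degree q" if "q \<in> polys_over F" "q \<noteq> 0" "poly q \<beta> = 0" for q
    unfolding m(4) by (rule Least_le) (use that S_def in blast)
  moreover have "degree m \<noteq> 0"
  proof
    assume "degree m = 0"
    then obtain c where "m = [:c:]" by (rule degree_eq_zeroE)
    then show False using m by simp
  qed
  ultimately show ?thesis using m by blast
qed

text \<open>For algebraic \<beta> the transported minimal polynomial keeps its positive degree, so
  the fundamental theorem of algebra supplies the conjugate \<gamma>.\<close>

lemma hom_extend_one:
  assumes cF: "countable F" and \<sigma>: "field_hom F \<sigma>"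
  shows "\<exists>F' \<sigma>'. complex_subfield F' \<and> countable F' \<and> F \<subseteq> F' \<and> \<beta> \<in> F' \<and> field_hom F' \<sigma>' \<and>
    (\<forall>x\<in>F. \<sigma>' x = \<sigma> x)"
proof -
  have "\<exists>\<gamma>. \<forall>p\<in>polys_over F. poly p \<beta> = 0 \<longleftrightarrow> poly (map_poly \<sigma> p) \<gamma> = 0"
  proof (cases "\<exists>p\<in>polys_over F. poly p \<beta> = 0 \<and> p \<noteq> 0")
    case True
    then obtain m where m: "m \<in> polys_over F" "m \<noteq> 0" "poly m \<beta> = 0" "degree m \<noteq> 0"
      "\<And>p. p \<in> polys_over F \<Longrightarrow> p \<noteq> 0 \<Longrightarrow> poly p \<beta> = 0 \<Longrightarrow> degree m \<le> degree p"
      using minimal_annihilating_poly by metis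
    have "degree (map_poly \<sigma> m) \<noteq> 0" using m degree_map_poly_hom[OF \<sigma>] by simp
    then obtain \<gamma> where "poly (map_poly \<sigma> m) \<gamma> = 0"
      using fundamental_theorem_of_algebra[of "map_poly \<sigma> m"] by (auto simp: constant_degree)
    then show ?thesis using hom_conjugate_algebraic[OF \<sigma> m(1,2,3,5)] by blast
  next
    case False
    then show ?thesis using hom_conjugate_transcendental[OF \<sigma> cF] by blast
  qed
  then show ?thesis using hom_extend_to[OF \<sigma> _ cF] by metis
qed

text \<open>The identity of F is extended with an image of \<beta> other than \<beta>. In the
  algebraic case this is a second root of the minimal polynomial m, obtained as a root of the
  cofactor k of the linear factor at \<beta>.\<close>

lemma hom_move:
  assumes cF: "countable F" and \<beta>: "\<beta> \<notin> F"
  shows "\<exists>F' \<sigma>. complex_subfield F' \<and> countable F' \<and> F \<subseteq> F' \<and> \<beta> \<in> F' \<and> field_hom F' \<sigma> \<and>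
    (\<forall>x\<in>F. \<sigma> x = x) \<and> \<sigma> \<beta> \<noteq> \<beta>"
proof -
  have id: "field_hom F (\<lambda>x. x)" by (simp add: field_hom_def)
  have [simp]: "map_poly (\<lambda>x. x) p = p" for p :: "complex poly"
    by (rule poly_eqI) (simp add: coeff_map_poly)
  have "\<exists>\<gamma>. \<gamma> \<noteq> \<beta> \<and> (\<forall>p\<in>polys_over F. poly p \<beta> = 0 \<longleftrightarrow> poly (map_poly (\<lambda>x. x) p) \<gamma> = 0)"
  proof (cases "\<exists>p\<in>polys_over F. poly p \<beta> = 0 \<and> p \<noteq> 0")
    case True
    then obtain m where m: "m \<in> polys_over F" "m \<noteq> 0" "poly m \<beta> = 0" "degree m \<noteq> 0"
      and min: "\<And>p. p \<in> polys_over F \<Longrightarrow> p \<noteq> 0 \<Longrightarrow> poly p \<beta> = 0 \<Longrightarrow> degree m \<le> degree p"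
      using minimal_annihilating_poly by metis
    obtain k where k: "m = [:- \<beta>, 1:] * k" using m(3) by (metis poly_eq_0_iff_dvd dvdE)
    have k0: "k \<noteq> 0" using k m by auto
    \<comment> \<open>A linear m would exhibit \<beta> as a quotient of its coefficients, hence as
      an element of F.\<close>
    have "degree m \<noteq> 1"
    proof
      assume d: "degree m = 1"
      have "poly m \<beta> = coeff m 0 + coeff m 1 * \<beta>" using d by (simp add: poly_altdef)
      then have "coeff m 1 * \<beta> = 0 - coeff m 0" using m(3) by (simp add: eq_neg_iff_add_eq_0 add.commute)
      moreover have "coeff m 1 \<noteq> 0" using m(2) d leading_coeff_0_iff[of m] by simp
      ultimately have "\<beta> = (0 - coeff m 0) / coeff m 1" by (simp add: field_simps)
      moreover have "(0 - coeff m 0) / coeff m 1 \<in> F"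
        by (intro subfield_divide subfield_diff subfield_zero) (use m(1) in \<open>simp_all add: polys_over_def\<close>)
      ultimately show False using \<beta> by simp
    qed
    moreover have dk: "degree m = Suc (degree k)"
      unfolding k using k0 by (subst degree_mult_eq) auto
    ultimately have "degree k \<noteq> 0" using m(4) by simp
    then obtain \<gamma> where \<gamma>: "poly k \<gamma> = 0"
      using fundamental_theorem_of_algebra[of k] by (auto simp: constant_degree)
    \<comment> \<open>Separability in characteristic 0: a double root would be a root of the
      derivative, which is nonzero, has coefficients in F and has smaller degree than m.\<close>
    have "\<gamma> \<noteq> \<beta>"
    proof
      assume "\<gamma> = \<beta>"
      then have "poly (pderiv m) \<beta> = 0" using \<gamma> unfolding k pderiv_mult by simp
      moreover have "pderiv m \<noteq> 0" using m(4) by (simp add: pderiv_eq_0_iff)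
      ultimately have "degree m \<le> degree (pderiv m)" using min polys_over_pderiv[OF m(1)] by blast
      then show False using m(4) by (simp add: degree_pderiv)
    qed
    moreover have "poly (map_poly (\<lambda>x. x) m) \<gamma> = 0" using \<gamma> by (simp add: k)
    ultimately show ?thesis using hom_conjugate_algebraic[OF id m(1,2,3) min] by blast
  next
    case False
    then show ?thesis using hom_conjugate_transcendental[OF id cF] by blast
  qed
  then obtain \<gamma> where "\<gamma> \<noteq> \<beta>"
    "\<And>p. p \<in> polys_over F \<Longrightarrow> poly p \<beta> = 0 \<longleftrightarrow> poly (map_poly (\<lambda>x. x) p) \<gamma> = 0" by blast
  then show ?thesis using hom_extend_to[OF id _ cF, of \<beta> \<gamma>] by metis
qed

end

lemma hom_extend_finite:
  assumes "finite B" "complex_subfield F" "countable F" "field_hom F \<sigma>"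
  shows "\<exists>F' \<sigma>'. complex_subfield F' \<and> countable F' \<and> F \<subseteq> F' \<and> B \<subseteq> F' \<and> field_hom F' \<sigma>' \<and>
    (\<forall>x\<in>F. \<sigma>' x = \<sigma> x)"
  using assms(1)
proof induction
  case empty
  then show ?case using assms by blast
next
  case (insert b B)
  then obtain F1 \<sigma>1 where 1: "complex_subfield F1" "countable F1" "F \<subseteq> F1" "B \<subseteq> F1"
    "field_hom F1 \<sigma>1" "\<forall>x\<in>F. \<sigma>1 x = \<sigma> x" by blast
  obtain F2 \<sigma>2 where 2: "complex_subfield F2" "countable F2" "F1 \<subseteq> F2" "b \<in> F2"
    "field_hom F2 \<sigma>2" "\<forall>x\<in>F1. \<sigma>2 x = \<sigma>1 x"
    using hom_extend_one[OF 1(1,2,5)] by blast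
  show ?case
    by (intro exI[of _ F2] exI[of _ \<sigma>2]) (use 1 2 in auto)
qed

text \<open>The element \<beta> is moved first; the extensions to the other elements agree with that
  homomorphism on its field and so cannot undo the move.\<close>

lemma hom_move_finite:
  assumes "finite B" "complex_subfield F" "countable F" "\<beta> \<notin> F"
  shows "\<exists>F' \<sigma>. complex_subfield F' \<and> F \<subseteq> F' \<and> insert \<beta> B \<subseteq> F' \<and> field_hom F' \<sigma> \<and>
    (\<forall>x\<in>F. \<sigma> x = x) \<and> \<sigma> \<beta> \<noteq> \<beta>"
proof -
  obtain F1 \<sigma>1 where 1: "complex_subfield F1" "countable F1" "F \<subseteq> F1" "\<beta> \<in> F1"
    "field_hom F1 \<sigma>1" "\<forall>x\<in>F. \<sigma>1 x = x" "\<sigma>1 \<beta> \<noteq> \<beta>"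
    using hom_move[OF assms(2-4)] by blast
  obtain F2 \<sigma>2 where 2: "complex_subfield F2" "F1 \<subseteq> F2" "B \<subseteq> F2"
    "field_hom F2 \<sigma>2" "\<forall>x\<in>F1. \<sigma>2 x = \<sigma>1 x"
    using hom_extend_finite[OF assms(1) 1(1,2,5)] by blast
  show ?thesis
    by (intro exI[of _ F2] exI[of _ \<sigma>2]) (use 1 2 in auto)
qed

section \<open>Homogeneous forms\<close>

text \<open>\<open>homogeneous_form\<close> sums over a set of exponent vectors, while sums and
  products of forms naturally give a family in which a vector may recur. The coefficients of equal
  vectors are collected.\<close>

lemma homogeneous_form_sumI:
  assumes "finite S" "\<And>s. s \<in> S \<Longrightarrow> (\<Sum>i\<in>I. m s i) = n"
  shows "homogeneous_form I n (\<lambda>y. \<Sum>s\<in>S. c s * (\<Prod>i\<in>I. y i ^ m s i))"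
  unfolding homogeneous_form_def
proof (intro exI conjI)
  show "finite (m ` S)" using assms(1) by simp
  show "\<forall>k\<in>m ` S. (\<Sum>i\<in>I. k i) = n" using assms(2) by auto
  show "(\<lambda>y. \<Sum>s\<in>S. c s * (\<Prod>i\<in>I. y i ^ m s i)) =
      (\<lambda>y. \<Sum>k\<in>m ` S. (\<Sum>s\<in>{s \<in> S. m s = k}. c s) * (\<Prod>i\<in>I. y i ^ k i))"
    by (rule ext, subst sum.image_gen[OF assms(1), of _ m])
      (auto simp: sum_distrib_right intro!: sum.cong)
qed

lemma homogeneous_form_const: "homogeneous_form I 0 (\<lambda>_. c)"
  using homogeneous_form_sumI[of "{()}" "\<lambda>_ _. 0" I 0 "\<lambda>_. c"] by simp

lemma homogeneous_form_zero: "homogeneous_form I n (\<lambda>_. 0)"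
  using homogeneous_form_sumI[of "{}" "\<lambda>_ _. 0" I] by simp

lemma homogeneous_form_coord:
  assumes "finite I" "i \<in> I"
  shows "homogeneous_form I 1 (\<lambda>y. y i)"
proof -
  have "(\<Prod>j\<in>I. y j ^ (if j = i then 1 else 0)) = y i" for y :: "'a \<Rightarrow> complex"
  proof -
    have "(\<Prod>j\<in>I. y j ^ (if j = i then 1 else 0)) = (\<Prod>j\<in>I. if j = i then y j else 1)"
      by (rule prod.cong) auto
    then show ?thesis using assms by simp
  qed
  then show ?thesis
    using homogeneous_form_sumI[of "{()}" "\<lambda>_ j. if j = i then 1 else 0" I 1 "\<lambda>_. 1"] assms
    by simp
qed

lemma homogeneous_form_add:
  assumes "homogeneous_form I n F" "homogeneous_form I n G"
  shows "homogeneous_form I n (\<lambda>y. F y + G y)"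
proof -
  obtain M c where M: "finite M" "\<forall>m\<in>M. (\<Sum>i\<in>I. m i) = n"
    "F = (\<lambda>y. \<Sum>m\<in>M. c m * (\<Prod>i\<in>I. y i ^ m i))"
    using assms(1) unfolding homogeneous_form_def by blast
  obtain N d where N: "finite N" "\<forall>m\<in>N. (\<Sum>i\<in>I. m i) = n"
    "G = (\<lambda>y. \<Sum>m\<in>N. d m * (\<Prod>i\<in>I. y i ^ m i))"
    using assms(2) unfolding homogeneous_form_def by blast
  have "(\<Sum>i\<in>I. case_sum id id s i) = n" if "s \<in> M <+> N" for s using that M(2) N(2) by auto
  then have "homogeneous_form I n
      (\<lambda>y. \<Sum>s\<in>M <+> N. case_sum c d s * (\<Prod>i\<in>I. y i ^ case_sum id id s i))"
    using M(1) N(1) by (intro homogeneous_form_sumI) auto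
  then show ?thesis unfolding M(3) N(3) using M(1) N(1) by (simp add: sum.Plus)
qed

lemma homogeneous_form_mult:
  assumes "homogeneous_form I n F" "homogeneous_form I k G"
  shows "homogeneous_form I (n + k) (\<lambda>y. F y * G y)"
proof -
  obtain M c where M: "finite M" "\<forall>m\<in>M. (\<Sum>i\<in>I. m i) = n"
    "F = (\<lambda>y. \<Sum>m\<in>M. c m * (\<Prod>i\<in>I. y i ^ m i))"
    using assms(1) unfolding homogeneous_form_def by blast
  obtain N d where N: "finite N" "\<forall>m\<in>N. (\<Sum>i\<in>I. m i) = k"
    "G = (\<lambda>y. \<Sum>m\<in>N. d m * (\<Prod>i\<in>I. y i ^ m i))"
    using assms(2) unfolding homogeneous_form_def by blast
  have "homogeneous_form I (n + k)
      (\<lambda>y. \<Sum>s\<in>M \<times> N. (c (fst s) * d (snd s)) * (\<Prod>i\<in>I. y i ^ (fst s i + snd s i)))"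
    using M(1,2) N(1,2) by (intro homogeneous_form_sumI) (auto simp: sum.distrib)
  moreover have "(\<Sum>s\<in>M \<times> N. (c (fst s) * d (snd s)) * (\<Prod>i\<in>I. y i ^ (fst s i + snd s i))) =
      F y * G y" for y
    unfolding M(3) N(3) sum_product sum.cartesian_product
    by (rule sum.cong) (auto simp: power_add prod.distrib)
  ultimately show ?thesis by simp
qed

lemma homogeneous_form_smult:
  "homogeneous_form I n F \<Longrightarrow> homogeneous_form I n (\<lambda>y. c * F y)"
  using homogeneous_form_mult[OF homogeneous_form_const] by fastforce

lemma homogeneous_form_diff:
  "homogeneous_form I n F \<Longrightarrow> homogeneous_form I n G \<Longrightarrow> homogeneous_form I n (\<lambda>y. F y - G y)"
  using homogeneous_form_add[of I n F "\<lambda>y. - 1 * G y"] homogeneous_form_smult[of I n G "- 1"]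
  by simp

lemma homogeneous_form_sum:
  "finite S \<Longrightarrow> (\<And>s. s \<in> S \<Longrightarrow> homogeneous_form I n (F s)) \<Longrightarrow>
    homogeneous_form I n (\<lambda>y. \<Sum>s\<in>S. F s y)"
  by (induction rule: finite_induct) (auto intro: homogeneous_form_zero homogeneous_form_add)

lemma homogeneous_form_power:
  "homogeneous_form I n F \<Longrightarrow> homogeneous_form I (k * n) (\<lambda>y. F y ^ k)"
  by (induction k) (auto intro: homogeneous_form_const homogeneous_form_mult)

lemma homogeneous_form_prod:
  "finite S \<Longrightarrow> (\<And>s. s \<in> S \<Longrightarrow> homogeneous_form I (n s) (F s)) \<Longrightarrow>
    homogeneous_form I (\<Sum>s\<in>S. n s) (\<lambda>y. \<Prod>s\<in>S. F s y)"
  by (induction rule: finite_induct) (auto intro: homogeneous_form_const homogeneous_form_mult)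

lemma homogeneous_form_polyfun:
  assumes "finite I" "homogeneous_form I n F"
  shows "F \<in> polyfun UNIV"
proof -
  obtain M c where M: "finite M" "F = (\<lambda>y. \<Sum>m\<in>M. c m * (\<Prod>i\<in>I. y i ^ m i))"
    using assms(2) unfolding homogeneous_form_def by blast
  show ?thesis unfolding M(2)
    by (intro polyfun_sum polyfun.mult polyfun_prod polyfun_power polyfun.const polyfun.coord)
      (use assms M in auto)
qed

lemma homogeneous_form_scale:
  assumes "homogeneous_form I n F"
  shows "F (\<lambda>i. c * y i) = c ^ n * F y"
proof -
  obtain M d where M: "finite M" "\<forall>m\<in>M. (\<Sum>i\<in>I. m i) = n"
    "F = (\<lambda>y. \<Sum>m\<in>M. d m * (\<Prod>i\<in>I. y i ^ m i))"
    using assms unfolding homogeneous_form_def by blast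
  have "d m * (\<Prod>i\<in>I. (c * y i) ^ m i) = c ^ n * (d m * (\<Prod>i\<in>I. y i ^ m i))" if "m \<in> M" for m
    using M(2) that by (simp add: power_mult_distrib prod.distrib flip: power_sum)
  then show ?thesis by (simp only: M(3) sum_distrib_left cong: sum.cong)
qed

text \<open>Clears denominators after substituting the ratios v i / s into P. Since s and v i may be
  any linear forms, this serves both the coordinates of the target space and their pullbacks along
  the tautological projection.\<close>

lemma homogenize:
  assumes "P \<in> polyfun UNIV" "homogeneous_form I 1 s" "\<And>i. homogeneous_form I 1 (v i)"
  shows "\<exists>n H. homogeneous_form I n H \<and>
    (\<forall>y. s y \<noteq> 0 \<longrightarrow> H y = s y ^ n * P (\<lambda>i. v i y / s y))"
  using assms(1)
proof induction
  case (const c)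
  show ?case using homogeneous_form_const[of I c] by (intro exI[of _ 0] exI[of _ "\<lambda>_. c"]) simp
next
  case (coord i)
  show ?case using assms(3)[of i] by (intro exI[of _ 1] exI[of _ "v i"]) simp
next
  case (add P Q)
  then obtain n H k G where H: "homogeneous_form I n H"
      "\<And>y. s y \<noteq> 0 \<Longrightarrow> H y = s y ^ n * P (\<lambda>i. v i y / s y)"
    and G: "homogeneous_form I k G"
      "\<And>y. s y \<noteq> 0 \<Longrightarrow> G y = s y ^ k * Q (\<lambda>i. v i y / s y)"
    by metis
  \<comment> \<open>Each summand receives the power of s of the other one, which makes the degrees
    equal.\<close>
  have "homogeneous_form I (k + n) (\<lambda>y. s y ^ k * H y)"
    using homogeneous_form_mult[OF homogeneous_form_power[OF assms(2), of k] H(1)] by simp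
  moreover have "homogeneous_form I (k + n) (\<lambda>y. s y ^ n * G y)"
    using homogeneous_form_mult[OF homogeneous_form_power[OF assms(2), of n] G(1)]
    by (simp add: add.commute)
  ultimately have "homogeneous_form I (k + n) (\<lambda>y. s y ^ k * H y + s y ^ n * G y)"
    by (rule homogeneous_form_add)
  then show ?case
    using H(2) G(2)
    by (intro exI[of _ "k + n"] exI[of _ "\<lambda>y. s y ^ k * H y + s y ^ n * G y"])
      (auto simp: power_add algebra_simps)
next
  case (mult P Q)
  then obtain n H k G where H: "homogeneous_form I n H"
      "\<And>y. s y \<noteq> 0 \<Longrightarrow> H y = s y ^ n * P (\<lambda>i. v i y / s y)"
    and G: "homogeneous_form I k G"
      "\<And>y. s y \<noteq> 0 \<Longrightarrow> G y = s y ^ k * Q (\<lambda>i. v i y / s y)"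
    by metis
  show ?case
    using H(2) G(2) homogeneous_form_mult[OF H(1) G(1)]
    by (intro exI[of _ "n + k"] exI[of _ "\<lambda>y. H y * G y"]) (auto simp: power_add algebra_simps)
qed

section \<open>Points of projective space\<close>

lemma proj_point_self: "y \<in> proj_point y"
  unfolding proj_point_def by (rule CollectI, rule exI[of _ 1]) simp

lemma proj_pointE:
  assumes "z \<in> proj_point y"
  obtains c where "c \<noteq> 0" "z = (\<lambda>i. c * y i)"
  using assms unfolding proj_point_def by blast

lemma proj_point_scale:
  assumes "c \<noteq> 0"
  shows "proj_point (\<lambda>i. c * y i) = proj_point y"
proof -
  have "\<exists>d. (\<lambda>i. b * y i) = (\<lambda>i. d * (c * y i)) \<and> d \<noteq> 0" if "b \<noteq> 0" for b
    using that assms by (intro exI[of _ "b / c"]) auto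
  moreover have "\<exists>d. (\<lambda>i. b * (c * y i)) = (\<lambda>i. d * y i) \<and> d \<noteq> 0" if "b \<noteq> 0" for b
    using that assms by (intro exI[of _ "b * c"]) auto
  ultimately show ?thesis unfolding proj_point_def by blast
qed

lemma proj_point_eqD:
  assumes "proj_point y = proj_point z"
  shows "\<exists>c. c \<noteq> 0 \<and> z = (\<lambda>i. c * y i)"
  using proj_point_self[of z] unfolding assms[symmetric] by (rule proj_pointE) blast

lemma complexify_proj_point:
  "complexify (proj_point y) = proj_point (\<lambda>i. complex_of_real (y i))"
proof -
  have "proj_point (\<lambda>i. complex_of_real (z i)) = proj_point (\<lambda>i. complex_of_real (y i))"
    if "z \<in> proj_point y" for z
  proof -
    from that obtain c where c: "c \<noteq> 0" "z = (\<lambda>i. c * y i)" by (rule proj_pointE)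
    then show ?thesis
      using proj_point_scale[of "complex_of_real c" "\<lambda>i. complex_of_real (y i)"] by simp
  qed
  then have "complexify (proj_point y) =
      (\<Union>z\<in>proj_point y. proj_point (\<lambda>i. complex_of_real (y i)))"
    unfolding complexify_def by (rule SUP_cong[OF refl])
  moreover have "proj_point y \<noteq> {}" using proj_point_self[of y] by force
  ultimately show ?thesis by (simp only: UN_constant if_False)
qed

section \<open>Binomial equations of the toric variety\<close>

definition laurent :: "real ^ 'd::finite \<Rightarrow> int ^ 'd \<Rightarrow> real" where
  "laurent t e = (\<Prod>i\<in>UNIV. (t $ i) powi (e $ i))"

lemma laurent_pos: "(\<And>i. t $ i > 0) \<Longrightarrow> laurent t e > 0"
  by (auto simp: laurent_def intro!: prod_pos zero_less_power_int)

lemma laurent_mult: "laurent (\<chi> i. s $ i * t $ i) e = laurent s e * laurent t e"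
  by (simp add: laurent_def power_int_mult_distrib prod.distrib)

lemma prod_laurent_power:
  assumes "\<And>i. t $ i > 0"
  shows "(\<Prod>a\<in>A. laurent t a ^ m a) = laurent t (\<chi> i. \<Sum>a\<in>A. int (m a) * a $ i)"
proof -
  have *: "(\<Prod>a\<in>A. (t $ i) powi (int (m a) * a $ i)) = (t $ i) powi (\<Sum>a\<in>A. int (m a) * a $ i)" for i
    using assms[of i] by (induction A rule: infinite_finite_induct) (simp_all add: power_int_add)
  have "(\<Prod>a\<in>A. laurent t a ^ m a) = (\<Prod>i\<in>UNIV. \<Prod>a\<in>A. (t $ i) powi (int (m a) * a $ i))"
    unfolding laurent_def prod_power_distrib
    by (subst prod.swap) (simp add: power_int_mult mult.commute[of "int _"])
  then show ?thesis by (simp add: laurent_def *)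
qed

lemma laurent_separates:
  assumes "e \<noteq> f"
  shows "\<exists>t. (\<forall>i. t $ i > 0) \<and> laurent t e \<noteq> laurent t f"
proof -
  obtain j where j: "e $ j \<noteq> f $ j" using assms by (auto simp: vec_eq_iff)
  define t :: "real ^ 'a" where "t = (\<chi> i. if i = j then 2 else 1)"
  have "laurent t g = 2 powi (g $ j)" for g
  proof -
    have "laurent t g = (\<Prod>i\<in>UNIV. if i = j then 2 powi (g $ i) else 1)"
      unfolding laurent_def by (rule prod.cong) (auto simp: t_def)
    then show ?thesis by simp
  qed
  moreover have "(2::real) powi (e $ j) \<noteq> 2 powi (f $ j)"
    using j by (metis linorder_neq_iff one_less_numeral_iff power_int_strict_increasing semiring_norm(76))
  moreover have "\<forall>i. t $ i > 0" by (simp add: t_def)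
  ultimately show ?thesis by metis
qed

text \<open>Dedekind's argument: replacing \<open>t\<close> by \<open>st\<close> and subtracting a multiple eliminates one character.\<close>

lemma laurent_independent:
  assumes "finite E" "\<And>t. (\<And>i. t $ i > 0) \<Longrightarrow> (\<Sum>e\<in>E. k e * complex_of_real (laurent t e)) = 0"
    and "e \<in> E"
  shows "k e = 0"
  using assms
proof (induction E arbitrary: k e rule: finite_induct)
  case empty
  then show ?case by simp
next
  case (insert f E)
  have E0: "k g = 0" if g: "g \<in> E" for g
  proof -
    have "g \<noteq> f" using g insert.hyps by blast
    then obtain s where s: "\<And>i. s $ i > 0" "laurent s g \<noteq> laurent s f"
      using laurent_separates by blast
    have "(\<Sum>e\<in>E. k e * of_real (laurent s e - laurent s f) * complex_of_real (laurent t e)) = 0"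
      if t: "\<And>i. t $ i > 0" for t
    proof -
      have "(\<Sum>e\<in>insert f E. k e * of_real (laurent (\<chi> i. s $ i * t $ i) e)) = (0::complex)"
        by (rule insert.prems(1)) (use s(1) t in simp)
      moreover have "(\<Sum>e\<in>insert f E. k e * complex_of_real (laurent t e)) = 0"
        by (rule insert.prems(1)) (use t in simp)
      ultimately have "(\<Sum>e\<in>insert f E. k e * of_real (laurent (\<chi> i. s $ i * t $ i) e)) -
          of_real (laurent s f) * (\<Sum>e\<in>insert f E. k e * complex_of_real (laurent t e)) = 0"
        by simp
      then have "(\<Sum>e\<in>insert f E. k e * of_real (laurent s e - laurent s f) * complex_of_real (laurent t e)) = 0"
        unfolding sum_distrib_left sum_subtractf[symmetric]
        by (simp add: laurent_mult algebra_simps)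
      then show ?thesis using insert.hyps by simp
    qed
    then have "k g * of_real (laurent s g - laurent s f) = 0"
      by (rule insert.IH) (use g in auto)
    then show ?thesis using s(2) by simp
  qed
  have "(\<Sum>e\<in>insert f E. k e * complex_of_real (laurent 1 e)) = 0"
    by (rule insert.prems(1)) simp
  then have "k f * complex_of_real (laurent 1 f) = 0" using insert.hyps E0 by simp
  then have "k f = 0" using laurent_pos[of 1 f] by simp
  then show ?case using E0 insert.prems(2) by blast
qed

text \<open>The difference of m and m' is an integer relation among the vectors (1, a). Such pairs
  index the binomials of the toric ideal.\<close>

definition same_moments :: "(int ^ 'd) set \<Rightarrow> (int ^ 'd \<Rightarrow> nat) \<Rightarrow> (int ^ 'd \<Rightarrow> nat) \<Rightarrow> bool" where
  "same_moments A m m' \<longleftrightarrow> (\<Sum>a\<in>A. m a) = (\<Sum>a\<in>A. m' a) \<and>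
     (\<forall>i. (\<Sum>a\<in>A. int (m a) * a $ i) = (\<Sum>a\<in>A. int (m' a) * a $ i))"

text \<open>Division by the weights moves the variety to the one with all weights 1, whose equations
  are pure binomials. All pairs are imposed at once instead of a finite generating set.\<close>

definition toric_binomials ::
    "(int ^ 'd) set \<Rightarrow> (int ^ 'd \<Rightarrow> real) \<Rightarrow> (int ^ 'd \<Rightarrow> complex) \<Rightarrow> bool" where
  "toric_binomials A w y \<longleftrightarrow> (\<forall>m m'. same_moments A m m' \<longrightarrow>
     (\<Prod>a\<in>A. (y a / of_real (w a)) ^ m a) = (\<Prod>a\<in>A. (y a / of_real (w a)) ^ m' a))"

lemma closedin_proj_topology_zeros:
  assumes "finite I" "homogeneous_form I n F"
  shows "closedin (proj_topology I)
    {p \<in> proj_space I. \<forall>y\<in>p. F (\<lambda>i. complex_of_real (y i)) = 0}" (is "closedin _ ?C")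
proof -
  have cont: "continuous_on UNIV (\<lambda>y. F (\<lambda>i. complex_of_real (y i)))"
  proof -
    obtain M c where M: "finite M" "F = (\<lambda>y. \<Sum>m\<in>M. c m * (\<Prod>i\<in>I. y i ^ m i))"
      using assms(2) unfolding homogeneous_form_def by blast
    show ?thesis unfolding M(2)
      by (intro continuous_intros continuous_on_product_coordinates)
  qed
  have mem: "(\<forall>z\<in>proj_point y. F (\<lambda>i. complex_of_real (z i)) = 0) \<longleftrightarrow>
      F (\<lambda>i. complex_of_real (y i)) = 0" for y
  proof
    assume *: "F (\<lambda>i. complex_of_real (y i)) = 0"
    show "\<forall>z\<in>proj_point y. F (\<lambda>i. complex_of_real (z i)) = 0"
    proof
      fix z assume "z \<in> proj_point y"
      then obtain c where "z = (\<lambda>i. c * y i)" by (rule proj_pointE)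
      then show "F (\<lambda>i. complex_of_real (z i)) = 0"
        using homogeneous_form_scale[OF assms(2), of "of_real c" "\<lambda>i. of_real (y i)"] *
        by simp
    qed
  qed (use proj_point_self in blast)
  have "{y \<in> nonzero_vecs I. proj_point y \<in> proj_space I - ?C} =
      nonzero_vecs I \<inter> (\<lambda>y. F (\<lambda>i. complex_of_real (y i))) -` (- {0})"
    using mem by (auto simp: proj_space_def)
  moreover have "open ((\<lambda>y. F (\<lambda>i. complex_of_real (y i))) -` (- {0}))"
    using cont by (intro open_vimage) auto
  ultimately show ?thesis
    unfolding closedin_def topspace_proj_topology openin_proj_topology by auto
qed

section \<open>The toric variety as the zero set of its binomials\<close>

context
  fixes A :: "(int ^ 'd::finite) set" and w :: "int ^ 'd \<Rightarrow> real"
  assumes A: "finite A" "A \<noteq> {}" and w: "\<And>a. a \<in> A \<Longrightarrow> w a > 0"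
begin

lemma monomial_vec_laurent: "monomial_vec A w t = (\<lambda>a. if a \<in> A then w a * laurent t a else 0)"
  unfolding monomial_vec_def laurent_def ..

lemma monomial_vec_nonzero:
  assumes "\<And>i. t $ i > 0"
  shows "monomial_vec A w t \<in> nonzero_vecs A"
proof -
  obtain a where "a \<in> A" using A by blast
  moreover have "monomial_vec A w t a \<noteq> 0"
    using w[OF \<open>a \<in> A\<close>] laurent_pos[OF assms, of a] \<open>a \<in> A\<close> by (simp add: monomial_vec_laurent)
  ultimately show ?thesis by (auto simp: nonzero_vecs_def monomial_vec_def)
qed

lemma monomial_vec_in_toric_X:
  assumes "\<And>i. t $ i > 0"
  shows "proj_point (monomial_vec A w t) \<in> toric_X A w"
proof -
  have "(\<lambda>x. proj_point (monomial_vec A w x)) ` {x. \<forall>i. x $ i > 0} \<subseteq> topspace (proj_topology A)"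
    using monomial_vec_nonzero by (auto simp: topspace_proj_topology proj_space_def)
  moreover have "proj_point (monomial_vec A w t) \<in>
      (\<lambda>x. proj_point (monomial_vec A w x)) ` {x. \<forall>i. x $ i > 0}"
    by (rule imageI) (simp add: assms)
  ultimately show ?thesis
    unfolding toric_X_def using closure_of_subset by (metis subsetD)
qed

lemma toric_X_subset: "toric_X A w \<subseteq> proj_space A"
  unfolding toric_X_def topspace_proj_topology[symmetric] by (rule closure_of_subset_topspace)

lemma toric_Y_subset: "toric_Y A w \<subseteq> proj_space A"
proof -
  have "zariski_closed A (proj_space A)"
    unfolding zariski_closed_def by (rule exI[of _ "{}"]) auto
  moreover have "complexify ` toric_X A w \<subseteq> proj_space A"
  proof
    fix q assume "q \<in> complexify ` toric_X A w"
    then obtain y where y: "y \<in> nonzero_vecs A" "q = complexify (proj_point y)"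
      using toric_X_subset by (auto simp: proj_space_def)
    moreover have "(\<lambda>i. complex_of_real (y i)) \<in> nonzero_vecs A"
      using y(1) by (auto simp: nonzero_vecs_def)
    ultimately show "q \<in> proj_space A" by (auto simp: complexify_proj_point proj_space_def)
  qed
  ultimately show ?thesis unfolding toric_Y_def by (simp add: hull_minimal)
qed

lemma toric_X_complexify: "proj_point y \<in> toric_X A w \<Longrightarrow>
    proj_point (\<lambda>a. complex_of_real (y a)) \<in> toric_Y A w"
  unfolding toric_Y_def by (metis complexify_proj_point hull_inc imageI)

text \<open>The zero set of a form is closed in the Euclidean topology, which takes vanishing from
  the image of the positive orthant to X, and it is Zariski closed, which takes it from X to
  Y.\<close>

lemma form_vanishes_on_toric_Y:
  assumes F: "homogeneous_form A n F"
    and 0: "\<And>t. (\<And>i. t $ i > 0) \<Longrightarrow> F (\<lambda>a. complex_of_real (monomial_vec A w t a)) = 0"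
    and p: "p \<in> toric_Y A w" and y: "y \<in> p"
  shows "F y = 0"
proof -
  let ?C = "{p \<in> proj_space A. \<forall>y\<in>p. F (\<lambda>i. complex_of_real (y i)) = 0}"
  let ?Z = "{p \<in> proj_space A. \<forall>F'\<in>{F}. \<forall>y\<in>p. F' y = 0}"
  have "proj_point (monomial_vec A w t) \<in> ?C" if t: "\<And>i. t $ i > 0" for t
  proof -
    have "F (\<lambda>i. complex_of_real (z i)) = 0" if "z \<in> proj_point (monomial_vec A w t)" for z
    proof -
      from that obtain c where "z = (\<lambda>i. c * monomial_vec A w t i)" by (rule proj_pointE)
      then show ?thesis
        using homogeneous_form_scale[OF F, of "of_real c" "\<lambda>a. of_real (monomial_vec A w t a)"] 0[OF t]
        by simp
    qed
    then show ?thesis using monomial_vec_nonzero[OF t] by (auto simp: proj_space_def)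
  qed
  then have "toric_X A w \<subseteq> ?C"
    unfolding toric_X_def
    by (intro closure_of_minimal closedin_proj_topology_zeros[OF A(1) F]) auto
  then have "complexify ` toric_X A w \<subseteq> ?Z"
  proof (intro subsetI)
    fix q assume "q \<in> complexify ` toric_X A w"
    then obtain r where r: "r \<in> toric_X A w" "q = complexify r" by blast
    then obtain x where x: "x \<in> nonzero_vecs A" "r = proj_point x"
      using toric_X_subset by (auto simp: proj_space_def)
    have Fx: "F (\<lambda>i. complex_of_real (x i)) = 0"
      using r(1) x(2) \<open>toric_X A w \<subseteq> ?C\<close> proj_point_self by blast
    have "F z = 0" if "z \<in> q" for z
    proof -
      have "z \<in> proj_point (\<lambda>i. complex_of_real (x i))"
        using that by (simp add: r(2) x(2) complexify_proj_point)
      then obtain c where "z = (\<lambda>i. c * complex_of_real (x i))" by (rule proj_pointE)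
      then show ?thesis using homogeneous_form_scale[OF F] Fx by simp
    qed
    moreover have "q \<in> proj_space A"
      using toric_Y_subset \<open>q \<in> complexify ` toric_X A w\<close>
      unfolding toric_Y_def by (meson hull_subset subsetD)
    ultimately show "q \<in> ?Z" by simp
  qed
  moreover have "zariski_closed A ?Z"
    unfolding zariski_closed_def by (rule exI[of _ "{F}"]) (use F in auto)
  ultimately have "toric_Y A w \<subseteq> ?Z" unfolding toric_Y_def by (rule hull_minimal)
  then show ?thesis using p y by blast
qed

lemma prod_monomial_vec:
  assumes "\<And>i. t $ i > 0"
  shows "(\<Prod>a\<in>A. complex_of_real (monomial_vec A w t a) ^ m a) =
    (\<Prod>a\<in>A. of_real (w a) ^ m a) * of_real (laurent t (\<chi> i. \<Sum>a\<in>A. int (m a) * a $ i))"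
proof -
  have "(\<Prod>a\<in>A. complex_of_real (monomial_vec A w t a) ^ m a) =
      (\<Prod>a\<in>A. of_real (w a) ^ m a * of_real (laurent t a ^ m a))"
    by (rule prod.cong) (auto simp: monomial_vec_laurent power_mult_distrib)
  then show ?thesis
    unfolding prod_laurent_power[OF assms, symmetric] by (simp add: prod.distrib)
qed

text \<open>On the image of the positive orthant both sides are the same Laurent monomial, and the
  binomial is homogeneous because m and m' have the same total degree.\<close>

lemma toric_Y_imp_binomials:
  assumes p: "p \<in> toric_Y A w" and y: "y \<in> p"
  shows "toric_binomials A w y"
  unfolding toric_binomials_def
proof (intro allI impI)
  fix m m' assume mm: "same_moments A m m'"
  define F where "F m y = (\<Prod>a\<in>A. (y a / complex_of_real (w a)) ^ m a)" for m y
  have form: "homogeneous_form A (\<Sum>a\<in>A. m a) (F m)" for m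
  proof -
    have "homogeneous_form A (m a * 1) (\<lambda>y. (y a / complex_of_real (w a)) ^ m a)" if "a \<in> A" for a
      using homogeneous_form_power[OF homogeneous_form_smult[OF homogeneous_form_coord[OF A(1) that],
          of "1 / complex_of_real (w a)"]] by simp
    then show ?thesis
      unfolding F_def using homogeneous_form_prod[OF A(1), of A m] by simp
  qed
  have Ft: "F k (\<lambda>a. complex_of_real (monomial_vec A w t a)) =
      of_real (laurent t (\<chi> i. \<Sum>a\<in>A. int (k a) * a $ i))" if t: "\<And>i. t $ i > 0" for t k
  proof -
    have "F k (\<lambda>a. complex_of_real (monomial_vec A w t a)) = (\<Prod>a\<in>A. of_real (laurent t a ^ k a))"
      unfolding F_def using w by (intro prod.cong) (force simp: monomial_vec_laurent)+
    then show ?thesis unfolding prod_laurent_power[OF t, symmetric] by simp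
  qed
  have eqs: "(\<Sum>a\<in>A. m' a) = (\<Sum>a\<in>A. m a)"
    "(\<chi> i. \<Sum>a\<in>A. int (m' a) * a $ i) = (\<chi> i. \<Sum>a\<in>A. int (m a) * a $ i)"
    using mm by (auto simp: same_moments_def)
  have "homogeneous_form A (\<Sum>a\<in>A. m a) (\<lambda>y. F m y - F m' y)"
    using form[of m] form[of m'] eqs(1) by (auto intro: homogeneous_form_diff)
  then have "F m y - F m' y = 0"
    by (rule form_vanishes_on_toric_Y[OF _ _ p y]) (simp add: Ft eqs(2))
  then show "(\<Prod>a\<in>A. (y a / of_real (w a)) ^ m a) = (\<Prod>a\<in>A. (y a / of_real (w a)) ^ m' a)"
    by (simp add: F_def)
qed

text \<open>A form vanishing on X becomes a Laurent polynomial that is zero on the positive orthant,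
  so its coefficients vanish by independence of the characters. The monomials of the form that
  contribute to one coefficient agree at y, up to weights, by the binomials. The argument does not
  parametrize y and so covers points with zero coordinates.\<close>

lemma binomials_imp_toric_Y:
  assumes y: "y \<in> nonzero_vecs A" and b: "toric_binomials A w y"
  shows "proj_point y \<in> toric_Y A w"
  unfolding toric_Y_def hull_def
proof (intro InterI, clarsimp)
  fix Z assume "zariski_closed A Z" and sub: "complexify ` toric_X A w \<subseteq> Z"
  then obtain \<F> where \<F>: "\<forall>F\<in>\<F>. \<exists>n. homogeneous_form A n F"
    "Z = {p \<in> proj_space A. \<forall>F\<in>\<F>. \<forall>y\<in>p. F y = 0}"
    unfolding zariski_closed_def by blast
  have Fy: "F y = 0 \<and> (\<exists>n. homogeneous_form A n F)" if F: "F \<in> \<F>" for F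
  proof -
    obtain n where Fn: "homogeneous_form A n F" using F \<F>(1) by blast
    then obtain M c where M: "finite M" "\<forall>m\<in>M. (\<Sum>i\<in>A. m i) = n"
      "F = (\<lambda>y. \<Sum>m\<in>M. c m * (\<Prod>i\<in>A. y i ^ m i))"
      unfolding homogeneous_form_def by blast
    define e where "e m = (\<chi> i. \<Sum>a\<in>A. int (m a) * a $ i)" for m :: "int ^ 'd \<Rightarrow> nat"
    define d where "d m = c m * (\<Prod>a\<in>A. complex_of_real (w a) ^ m a)" for m
    \<comment> \<open>The coefficient of the Laurent monomial with exponent f in the pullback of F;
      the weights are absorbed in \<open>d\<close>.\<close>
    define k where "k f = (\<Sum>m\<in>{m \<in> M. e m = f}. d m)" for f
    have k0: "k f = 0" if f: "f \<in> e ` M" for f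
    proof (rule laurent_independent[OF _ _ f])
      show "finite (e ` M)" using M by simp
      fix t :: "real ^ 'd" assume t: "\<And>i. t $ i > 0"
      have "complexify (proj_point (monomial_vec A w t)) \<in> Z"
        using sub monomial_vec_in_toric_X[OF t] by blast
      then have "0 = F (\<lambda>a. complex_of_real (monomial_vec A w t a))"
        using F proj_point_self[of "\<lambda>a. complex_of_real (monomial_vec A w t a)"]
        unfolding complexify_proj_point \<F>(2) by simp
      also have "\<dots> = (\<Sum>m\<in>M. d m * of_real (laurent t (e m)))"
        unfolding M(3) by (simp add: prod_monomial_vec[OF t] d_def e_def mult.assoc)
      also have "\<dots> = (\<Sum>f\<in>e ` M. \<Sum>m\<in>{m \<in> M. e m = f}. d m * of_real (laurent t (e m)))"
        by (rule sum.image_gen[OF M(1)])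
      also have "\<dots> = (\<Sum>f\<in>e ` M. k f * of_real (laurent t f))"
        by (auto simp: k_def sum_distrib_right intro!: sum.cong)
      finally show "(\<Sum>f\<in>e ` M. k f * complex_of_real (laurent t f)) = 0" by simp
    qed
    define g where "g m = (\<Prod>a\<in>A. (y a / complex_of_real (w a)) ^ m a)" for m
    have "F y = (\<Sum>m\<in>M. d m * g m)"
      unfolding M(3)
    proof (rule sum.cong[OF refl])
      fix m
      have "(\<Prod>a\<in>A. y a ^ m a) = (\<Prod>a\<in>A. complex_of_real (w a) ^ m a * (y a / complex_of_real (w a)) ^ m a)"
        using w by (intro prod.cong) (force simp: power_mult_distrib[symmetric])+
      then show "c m * (\<Prod>a\<in>A. y a ^ m a) = d m * g m"
        by (simp add: d_def g_def prod.distrib)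
    qed
    also have "\<dots> = (\<Sum>f\<in>e ` M. \<Sum>m\<in>{m \<in> M. e m = f}. d m * g m)"
      by (rule sum.image_gen[OF M(1)])
    also have "\<dots> = 0"
    proof (rule sum.neutral, rule ballI)
      fix f assume "f \<in> e ` M"
      then obtain m0 where m0: "m0 \<in> M" "e m0 = f" by blast
      have "g m = g m0" if "m \<in> M" "e m = f" for m
      proof -
        \<comment> \<open>Equality of the total degrees comes from the homogeneity of F, equality of
          the other moments from \<open>e\<close>.\<close>
        have "same_moments A m m0"
          using that m0 M(2) by (auto simp: same_moments_def e_def vec_eq_iff)
        then show ?thesis using b unfolding toric_binomials_def g_def by blast
      qed
      then have "(\<Sum>m\<in>{m \<in> M. e m = f}. d m * g m) = (\<Sum>m\<in>{m \<in> M. e m = f}. d m * g m0)"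
        by (intro sum.cong) auto
      then show "(\<Sum>m\<in>{m \<in> M. e m = f}. d m * g m) = 0"
        using k0[OF \<open>f \<in> e ` M\<close>] by (simp add: k_def flip: sum_distrib_right)
    qed
    finally show ?thesis using Fn by blast
  qed
  have "F z = 0" if "F \<in> \<F>" "z \<in> proj_point y" for F z
  proof -
    from that(2) obtain c where "z = (\<lambda>i. c * y i)" by (rule proj_pointE)
    then show ?thesis using Fy[OF that(1)] homogeneous_form_scale[of A _ F c y] by auto
  qed
  then show "proj_point y \<in> Z" using y by (auto simp: \<F> proj_space_def)
qed

end

section \<open>Rational functions\<close>

lemma real_polynomial_function_complexify:
  fixes p :: "real ^ 'd::finite \<Rightarrow> real"
  assumes "real_polynomial_function p"
  shows "\<exists>P\<in>polyfun UNIV. \<forall>x. P (cvec x) = complex_of_real (p x)"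
  using assms
proof induction
  case (linear f)
  have f: "f x = (\<Sum>i\<in>UNIV. x $ i * f (axis i 1))" for x
  proof -
    have "f x = f (\<Sum>i\<in>UNIV. x $ i *\<^sub>R axis i 1)"
      using basis_expansion[of x] by (simp add: scalar_mult_eq_scaleR)
    also have "\<dots> = (\<Sum>i\<in>UNIV. x $ i * f (axis i 1))"
      using bounded_linear.linear[OF linear] by (simp add: linear_sum linear_cmul)
    finally show ?thesis .
  qed
  have "(\<Sum>i\<in>UNIV. cvec x i * of_real (f (axis i 1))) = complex_of_real (f x)" for x
    by (subst f[of x]) (simp add: cvec_def)
  moreover have "(\<lambda>z. \<Sum>i\<in>UNIV. z i * complex_of_real (f (axis i 1))) \<in> polyfun UNIV"
    by (intro polyfun_sum polyfun.mult polyfun.coord polyfun.const) auto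
  ultimately show ?case by (intro bexI[rotated]) auto
next
  case (const c)
  show ?case by (rule bexI[of _ "\<lambda>_. complex_of_real c"]) (auto intro: polyfun.const)
next
  case (add f g)
  then obtain P Q where "P \<in> polyfun UNIV" "Q \<in> polyfun UNIV"
    "\<And>x. P (cvec x) = complex_of_real (f x)" "\<And>x. Q (cvec x) = complex_of_real (g x)" by metis
  then show ?case by (intro bexI[of _ "\<lambda>z. P z + Q z"]) (auto intro: polyfun.add)
next
  case (mult f g)
  then obtain P Q where "P \<in> polyfun UNIV" "Q \<in> polyfun UNIV"
    "\<And>x. P (cvec x) = complex_of_real (f x)" "\<And>x. Q (cvec x) = complex_of_real (g x)" by metis
  then show ?case by (intro bexI[of _ "\<lambda>z. P z * Q z"]) (auto intro: polyfun.mult)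
qed

lemma polyfun_real_polynomial_function:
  fixes P :: "('d::finite \<Rightarrow> complex) \<Rightarrow> complex"
  assumes "P \<in> polyfun K"
  shows "real_polynomial_function (\<lambda>x. Re (P (cvec x))) \<and>
    real_polynomial_function (\<lambda>x. Im (P (cvec x)))"
  using assms
proof induction
  case (const c)
  show ?case by auto
next
  case (coord i)
  show ?case using bounded_linear_vec_nth by (auto simp: cvec_def)
next
  case (add P Q)
  then show ?case by auto
next
  case (mult P Q)
  then show ?case by (auto intro!: real_polynomial_function_diff)
qed

lemma polyfun_real:
  assumes "P \<in> polyfun K" "K \<subseteq> \<real>" "\<And>i. z i \<in> \<real>"
  shows "P z \<in> \<real>"
  using assms(1) by induction (use assms(2,3) in auto)

text \<open>Since \<open>x / 0 = 0\<close>, vanishing denominators contribute nothing new.\<close>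

definition adjoin :: "complex set \<Rightarrow> ('i \<Rightarrow> complex) \<Rightarrow> complex set" where
  "adjoin K v = {P v / Q v |P Q. P \<in> polyfun K \<and> Q \<in> polyfun K}"

lemma adjoinI: "P \<in> polyfun K \<Longrightarrow> Q \<in> polyfun K \<Longrightarrow> P v / Q v \<in> adjoin K v"
  unfolding adjoin_def by blast

lemma adjoinE:
  assumes "x \<in> adjoin K v" "0 \<in> K" "1 \<in> K"
  obtains P Q where "P \<in> polyfun K" "Q \<in> polyfun K" "x = P v / Q v" "Q v \<noteq> 0"
proof -
  obtain P Q where PQ: "P \<in> polyfun K" "Q \<in> polyfun K" "x = P v / Q v"
    using assms(1) unfolding adjoin_def by blast
  show ?thesis
  proof (cases "Q v = 0")
    case True
    then show ?thesis
      using that[of "\<lambda>_. 0" "\<lambda>_. 1"] assms(2,3) PQ(3) by (simp add: polyfun.const)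
  qed (use that PQ in blast)
qed

lemma adjoin_base: "1 \<in> K \<Longrightarrow> c \<in> K \<Longrightarrow> c \<in> adjoin K v"
  using adjoinI[of "\<lambda>_. c" K "\<lambda>_. 1" v] by (simp add: polyfun.const)

lemma adjoin_coord: "1 \<in> K \<Longrightarrow> v i \<in> adjoin K v"
  using adjoinI[of "\<lambda>z. z i" K "\<lambda>_. 1" v] by (simp add: polyfun.const polyfun.coord)

lemma countable_adjoin:
  fixes v :: "'i::countable \<Rightarrow> complex"
  assumes "countable K"
  shows "countable (adjoin K v)"
proof -
  have "adjoin K v \<subseteq> (\<lambda>(P, Q). P v / Q v) ` (polyfun K \<times> polyfun K)"
    unfolding adjoin_def by force
  moreover have "countable (polyfun K \<times> polyfun K :: ((('i \<Rightarrow> complex) \<Rightarrow> complex) \<times> (('i \<Rightarrow> complex) \<Rightarrow> complex)) set)"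
    by (intro countable_SIGMA countable_polyfun assms)
  ultimately show ?thesis by (meson countable_image countable_subset)
qed

lemma complex_subfield_adjoin:
  assumes "0 \<in> K" "1 \<in> K" "- 1 \<in> K"
  shows "complex_subfield (adjoin K v)"
  unfolding complex_subfield_def
proof (intro conjI ballI)
  show "1 \<in> adjoin K v" using assms by (intro adjoin_base)
  fix x assume "x \<in> adjoin K v"
  then obtain P Q where x: "P \<in> polyfun K" "Q \<in> polyfun K" "x = P v / Q v" "Q v \<noteq> 0"
    using assms by (elim adjoinE)
  show "inverse x \<in> adjoin K v" using adjoinI[OF x(2,1), of v] by (simp add: x(3))
  fix y assume "y \<in> adjoin K v"
  then obtain R S where y: "R \<in> polyfun K" "S \<in> polyfun K" "y = R v / S v" "S v \<noteq> 0"
    using assms by (elim adjoinE)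
  have 1: "(\<lambda>z. P z * S z + - 1 * (R z * Q z)) \<in> polyfun K" "(\<lambda>z. P z * R z) \<in> polyfun K"
    and 2: "(\<lambda>z. Q z * S z) \<in> polyfun K"
    by (intro polyfun.add polyfun.mult polyfun.const x(1,2) y(1,2) assms)+
  have "x - y = (P v * S v + - 1 * (R v * Q v)) / (Q v * S v)"
    using x(4) y(4) by (simp add: x(3) y(3) field_simps)
  then show "x - y \<in> adjoin K v" using adjoinI[OF 1(1) 2, of v] by simp
  show "x * y \<in> adjoin K v" using adjoinI[OF 1(2) 2, of v] by (simp add: x(3) y(3))
qed

lemma adjoin_real:
  assumes "K \<subseteq> \<real>" "\<And>i. v i \<in> \<real>"
  shows "adjoin K v \<subseteq> \<real>"
  unfolding adjoin_def using polyfun_real[OF _ assms] by (auto intro!: Reals_divide)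

text \<open>Values where \<open>D\<close> vanishes are unconstrained.\<close>

definition ratfun :: "complex set \<Rightarrow> (('i \<Rightarrow> complex) \<Rightarrow> complex) \<Rightarrow> (('i \<Rightarrow> complex) \<Rightarrow> complex) set" where
  "ratfun K D = {f. \<exists>N\<in>polyfun K. \<exists>k. \<forall>z. D z \<noteq> 0 \<longrightarrow> f z * D z ^ k = N z}"

lemma ratfunI:
  assumes "N \<in> polyfun K" "\<And>z. D z \<noteq> 0 \<Longrightarrow> f z * D z ^ k = N z"
  shows "f \<in> ratfun K D"
  unfolding ratfun_def using assms by blast

lemma ratfun_polyfun: "P \<in> polyfun K \<Longrightarrow> P \<in> ratfun K D"
  unfolding ratfun_def by (rule CollectI, rule bexI[of _ P], rule exI[of _ 0]) auto

context
  fixes K D assumes K: "1 \<in> K" and D: "D \<in> polyfun K"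
begin

lemma ratfun_add:
  assumes "f \<in> ratfun K D" "g \<in> ratfun K D"
  shows "(\<lambda>z. f z + g z) \<in> ratfun K D"
proof -
  obtain N k where N: "N \<in> polyfun K" "\<And>z. D z \<noteq> 0 \<Longrightarrow> f z * D z ^ k = N z"
    using assms(1) unfolding ratfun_def by blast
  obtain M l where M: "M \<in> polyfun K" "\<And>z. D z \<noteq> 0 \<Longrightarrow> g z * D z ^ l = M z"
    using assms(2) unfolding ratfun_def by blast
  have "(\<lambda>z. N z * D z ^ l + M z * D z ^ k) \<in> polyfun K"
    using N M D K by (intro polyfun.add polyfun.mult polyfun_power)
  moreover have "(f z + g z) * D z ^ (k + l) = N z * D z ^ l + M z * D z ^ k" if "D z \<noteq> 0" for z
    using N(2)[OF that, symmetric] M(2)[OF that, symmetric] by (simp add: power_add algebra_simps)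
  ultimately show ?thesis by (rule ratfunI)
qed

lemma ratfun_mult:
  assumes "f \<in> ratfun K D" "g \<in> ratfun K D"
  shows "(\<lambda>z. f z * g z) \<in> ratfun K D"
proof -
  obtain N k where N: "N \<in> polyfun K" "\<And>z. D z \<noteq> 0 \<Longrightarrow> f z * D z ^ k = N z"
    using assms(1) unfolding ratfun_def by blast
  obtain M l where M: "M \<in> polyfun K" "\<And>z. D z \<noteq> 0 \<Longrightarrow> g z * D z ^ l = M z"
    using assms(2) unfolding ratfun_def by blast
  have "(\<lambda>z. N z * M z) \<in> polyfun K" using N M by (intro polyfun.mult)
  moreover have "(f z * g z) * D z ^ (k + l) = N z * M z" if "D z \<noteq> 0" for z
    using N(2)[OF that, symmetric] M(2)[OF that, symmetric] by (simp add: power_add algebra_simps)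
  ultimately show ?thesis by (rule ratfunI)
qed

lemma ratfun_sum:
  assumes "0 \<in> K" "finite S" "\<And>s. s \<in> S \<Longrightarrow> f s \<in> ratfun K D"
  shows "(\<lambda>z. \<Sum>s\<in>S. f s z) \<in> ratfun K D"
  using assms(2,3)
  by induction (auto intro: ratfun_add ratfun_polyfun polyfun.const assms(1))

lemma ratfun_power: "f \<in> ratfun K D \<Longrightarrow> (\<lambda>z. f z ^ n) \<in> ratfun K D"
  by (induction n) (auto intro: ratfun_mult ratfun_polyfun polyfun.const K)

lemma ratfun_prod:
  assumes "finite S" "\<And>s. s \<in> S \<Longrightarrow> f s \<in> ratfun K D"
  shows "(\<lambda>z. \<Prod>s\<in>S. f s z) \<in> ratfun K D"
  using assms by induction (auto intro: ratfun_mult ratfun_polyfun polyfun.const K)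

text \<open>The hypothesis on S concerns polynomials, while f is controlled on S only where D is
  nonzero. The numerator times D vanishes on all of S, and at z0 the factor D cancels.\<close>

lemma ratfun_eq_0:
  assumes f: "f \<in> ratfun K D"
    and S: "\<And>R. R \<in> polyfun K \<Longrightarrow> (\<And>z. z \<in> S \<Longrightarrow> R z = 0) \<Longrightarrow> R z0 = 0"
    and f0: "\<And>z. z \<in> S \<Longrightarrow> D z \<noteq> 0 \<Longrightarrow> f z = 0" and z0: "D z0 \<noteq> 0"
  shows "f z0 = 0"
proof -
  obtain N k where N: "N \<in> polyfun K" "\<And>z. D z \<noteq> 0 \<Longrightarrow> f z * D z ^ k = N z"
    using f unfolding ratfun_def by blast
  have "(\<lambda>z. N z * D z) \<in> polyfun K" using N D by (intro polyfun.mult)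
  moreover have "N z * D z = 0" if "z \<in> S" for z
    using N(2)[of z] f0[OF that] by (cases "D z = 0") auto
  ultimately have "N z0 * D z0 = 0" by (rule S)
  then show ?thesis using N(2)[OF z0] z0 by auto
qed

end

section \<open>Fibres of the tautological projection\<close>

definition affine_point :: "('d \<Rightarrow> complex) \<Rightarrow> 'd option \<Rightarrow> complex" where
  "affine_point z = (\<lambda>j. case j of None \<Rightarrow> 1 | Some i \<Rightarrow> z i)"

text \<open>The likelihood equations for normalized homogeneous coordinates \<open>y\<close> on the fibre over \<open>z\<close>.\<close>

definition fibre_eqs ::
    "(int ^ 'd::finite) set \<Rightarrow> (int ^ 'd \<Rightarrow> real) \<Rightarrow> ('d \<Rightarrow> complex) \<Rightarrow> (int ^ 'd \<Rightarrow> complex) \<Rightarrow> bool" where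
  "fibre_eqs A w z y \<longleftrightarrow> (\<forall>a. a \<notin> A \<longrightarrow> y a = 0) \<and> (\<Sum>a\<in>A. y a) = 1 \<and>
     (\<forall>i. (\<Sum>a\<in>A. y a * of_int (a $ i)) = z i) \<and> toric_binomials A w y"

lemma tautological_lin_None: "tautological_lin A y None = (\<Sum>a\<in>A. y a)"
  and tautological_lin_Some: "tautological_lin A y (Some i) = (\<Sum>a\<in>A. y a * of_int (a $ i))"
  by (simp_all add: tautological_lin_def)

lemma tautological_lin_scale:
  "tautological_lin A (\<lambda>a. c * y a) = (\<lambda>j. c * tautological_lin A y j)"
  by (auto simp: tautological_lin_def sum_distrib_left mult.assoc)

lemma proj_point_image: "proj_point x = (\<lambda>c i. c * x i) ` {c. c \<noteq> 0}"
  unfolding proj_point_def by blast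

lemma tautological_proj_point:
  "tautological_proj A (proj_point y) = proj_point (tautological_lin A y)"
  by (simp add: tautological_proj_def proj_point_image image_image tautological_lin_scale)

lemma fibre_eqs_lin:
  assumes "fibre_eqs A w z y"
  shows "tautological_lin A y = affine_point z"
proof
  fix j show "tautological_lin A y j = affine_point z j"
    using assms by (cases j)
      (auto simp: tautological_lin_None tautological_lin_Some affine_point_def fibre_eqs_def)
qed

lemma fibre_eqs_nonzero: "fibre_eqs A w z y \<Longrightarrow> y \<in> nonzero_vecs A"
proof -
  assume f: "fibre_eqs A w z y"
  have "\<exists>a\<in>A. y a \<noteq> 0"
  proof (rule ccontr)
    assume "\<not> (\<exists>a\<in>A. y a \<noteq> 0)"
    then have "(\<Sum>a\<in>A. y a) = 0" by simp
    then show False using f by (simp add: fibre_eqs_def)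
  qed
  then show ?thesis using f by (simp add: nonzero_vecs_def fibre_eqs_def)
qed

lemma fibre_eqs_unique:
  assumes "fibre_eqs A w z y" "fibre_eqs A w z' y'" "proj_point y = proj_point y'"
  shows "y = y'"
proof -
  obtain c where c: "y' = (\<lambda>a. c * y a)" using proj_point_eqD[OF assms(3)] by blast
  have "(\<Sum>a\<in>A. y' a) = c * (\<Sum>a\<in>A. y a)" by (simp add: c sum_distrib_left)
  then have "c = 1" using assms by (simp add: fibre_eqs_def)
  then show ?thesis using c by simp
qed

context
  fixes A :: "(int ^ 'd::finite) set" and w :: "int ^ 'd \<Rightarrow> real"
  assumes A: "finite A" "A \<noteq> {}" and w: "\<And>a. a \<in> A \<Longrightarrow> w a > 0"
begin

lemma fibre_eqs_mem_fibre:
  assumes "fibre_eqs A w z y"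
  shows "proj_point y \<in> {p \<in> toric_Y A w. tautological_proj A p = proj_point (affine_point z)}"
  using assms binomials_imp_toric_Y[where w = w, OF A w fibre_eqs_nonzero[OF assms]]
  by (simp add: tautological_proj_point fibre_eqs_lin[OF assms] fibre_eqs_def)

lemma mem_fibre_fibre_eqs:
  assumes "p \<in> toric_Y A w" "tautological_proj A p = proj_point (affine_point z)"
  shows "\<exists>y. fibre_eqs A w z y \<and> p = proj_point y"
proof -
  obtain y0 where y0: "y0 \<in> nonzero_vecs A" "p = proj_point y0"
    using subsetD[OF toric_Y_subset[where w = w, OF A w] assms(1)] unfolding proj_space_def by blast
  have "proj_point (tautological_lin A y0) = proj_point (affine_point z)"
    using assms(2) by (simp add: y0(2) tautological_proj_point)
  then obtain c where c: "c \<noteq> 0" "affine_point z = (\<lambda>j. c * tautological_lin A y0 j)"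
    using proj_point_eqD by metis
  define y where "y = (\<lambda>a. c * y0 a)"
  have p: "p = proj_point y" using c(1) by (simp add: y_def y0(2) proj_point_scale)
  have lin: "tautological_lin A y = affine_point z"
    unfolding y_def tautological_lin_scale c(2) ..
  have "toric_binomials A w y"
    by (rule toric_Y_imp_binomials[where w = w, OF A w assms(1)]) (simp_all add: p proj_point_self)
  then have "fibre_eqs A w z y"
    using y0(1) fun_cong[OF lin, of None] fun_cong[OF lin, of "Some _"]
    by (simp add: fibre_eqs_def y_def nonzero_vecs_def tautological_lin_None
        tautological_lin_Some affine_point_def)
  then show ?thesis using p by blast
qed

text \<open>The normalization to sum 1 selects one homogeneous vector from each point of the fibre,
  so points of the fibre correspond to solutions of \<open>fibre_eqs\<close>.\<close>

lemma fibre_card_1_iff: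
  "(finite {p \<in> toric_Y A w. tautological_proj A p = proj_point (affine_point z)} \<and>
    card {p \<in> toric_Y A w. tautological_proj A p = proj_point (affine_point z)} = 1) \<longleftrightarrow>
   (\<exists>!y. fibre_eqs A w z y)" (is "finite ?S \<and> card ?S = 1 \<longleftrightarrow> _")
proof
  assume "finite ?S \<and> card ?S = 1"
  then obtain p where p: "?S = {p}" by (auto simp: card_1_singleton_iff)
  then have "p \<in> ?S" by blast
  then obtain y where y: "fibre_eqs A w z y" "p = proj_point y"
    using mem_fibre_fibre_eqs[of p z] by blast
  have "y' = y" if "fibre_eqs A w z y'" for y'
  proof -
    have "proj_point y' = p" using fibre_eqs_mem_fibre[OF that] unfolding p by simp
    then show ?thesis using fibre_eqs_unique[OF that y(1)] y(2) by simp
  qed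
  then show "\<exists>!y. fibre_eqs A w z y" using y(1) by blast
next
  assume "\<exists>!y. fibre_eqs A w z y"
  then obtain y where y: "fibre_eqs A w z y" "\<And>y'. fibre_eqs A w z y' \<Longrightarrow> y' = y" by blast
  have "?S = {proj_point y}"
  proof
    show "{proj_point y} \<subseteq> ?S" using fibre_eqs_mem_fibre[OF y(1)] by simp
    show "?S \<subseteq> {proj_point y}"
    proof
      fix p assume "p \<in> ?S"
      then obtain y' where "fibre_eqs A w z y'" "p = proj_point y'"
        using mem_fibre_fibre_eqs[of p z] by blast
      then show "p \<in> {proj_point y}" using y(2) by simp
    qed
  qed
  then show "finite ?S \<and> card ?S = 1" by simp
qed

text \<open>Each of the equations is the vanishing of a rational function of \<open>z\<close>.\<close>

lemma fibre_eqs_transfer: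
  fixes P Q :: "int ^ 'd \<Rightarrow> ('d \<Rightarrow> complex) \<Rightarrow> complex"
  assumes K: "complex_subfield K" "\<And>a. a \<in> A \<Longrightarrow> complex_of_real (w a) \<in> K"
    and P: "\<And>a. a \<in> A \<Longrightarrow> P a \<in> polyfun K" and Q: "\<And>a. a \<in> A \<Longrightarrow> Q a \<in> polyfun K"
    and S: "\<And>R. R \<in> polyfun K \<Longrightarrow> (\<And>z. z \<in> S \<Longrightarrow> R z = 0) \<Longrightarrow> R z0 = 0"
    and eqs: "\<And>z. z \<in> S \<Longrightarrow> (\<And>a. a \<in> A \<Longrightarrow> Q a z \<noteq> 0) \<Longrightarrow>
      fibre_eqs A w z (\<lambda>a. if a \<in> A then P a z / Q a z else 0)"
    and z0: "\<And>a. a \<in> A \<Longrightarrow> Q a z0 \<noteq> 0"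
  shows "fibre_eqs A w z0 (\<lambda>a. if a \<in> A then P a z0 / Q a z0 else 0)"
proof -
  \<comment> \<open>A common denominator for all the fractions, which puts every defining equation
    into \<open>ratfun K D\<close>.\<close>
  define D where "D z = (\<Prod>a\<in>A. Q a z)" for z
  have K01: "0 \<in> K" "1 \<in> K" using subfield_zero subfield_one K(1) by blast+
  have D: "D \<in> polyfun K" unfolding D_def using K01 A(1) Q by (intro polyfun_prod)
  have D0: "D z \<noteq> 0 \<longleftrightarrow> (\<forall>a\<in>A. Q a z \<noteq> 0)" for z using A(1) by (simp add: D_def)
  define f where "f a z = P a z / Q a z" for a z
  have f: "f a \<in> ratfun K D" if a: "a \<in> A" for a
  proof -
    have "(\<lambda>z. P a z * (\<Prod>b\<in>A - {a}. Q b z)) \<in> polyfun K"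
      using P Q a A(1) K01 by (intro polyfun.mult polyfun_prod) auto
    moreover have "f a z * D z ^ 1 = P a z * (\<Prod>b\<in>A - {a}. Q b z)" if "D z \<noteq> 0" for z
    proof -
      have "D z = Q a z * (\<Prod>b\<in>A - {a}. Q b z)"
        unfolding D_def by (rule prod.remove[OF A(1) a])
      then show ?thesis using that a D0 by (simp add: f_def)
    qed
    ultimately show ?thesis by (rule ratfunI)
  qed
  note rat = ratfun_add[OF K01(2) D] ratfun_mult[OF K01(2) D] ratfun_sum[OF K01(2) D K01(1) A(1)]
    ratfun_power[OF K01(2) D] ratfun_prod[OF K01(2) D A(1)] ratfun_polyfun polyfun.const
    polyfun.coord polyfun.add polyfun.mult
  have m1: "- 1 \<in> K" using subfield_diff[OF K(1) K01] by simp
  have zero: "h z0 = 0" if "h \<in> ratfun K D" "\<And>z. z \<in> S \<Longrightarrow> D z \<noteq> 0 \<Longrightarrow> h z = 0" for h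
    by (rule ratfun_eq_0[OF K01(2) D that(1) S that(2)]) (use z0 D0 in blast)+
  have eqs': "fibre_eqs A w z (\<lambda>a. if a \<in> A then f a z else 0)" if "z \<in> S" "D z \<noteq> 0" for z
    unfolding f_def by (rule eqs) (use that D0 in blast)+
  have "(\<Sum>a\<in>A. f a z0) + - 1 = 0"
  proof (rule zero)
    show "(\<lambda>z. (\<Sum>a\<in>A. f a z) + - 1) \<in> ratfun K D" by (intro rat f m1)
    show "(\<Sum>a\<in>A. f a z) + - 1 = 0" if "z \<in> S" "D z \<noteq> 0" for z
      using eqs'[OF that] by (simp add: fibre_eqs_def)
  qed
  moreover have "(\<Sum>a\<in>A. f a z0 * of_int (a $ i)) + - 1 * z0 i = 0" for i
  proof (rule zero)
    show "(\<lambda>z. (\<Sum>a\<in>A. f a z * of_int (a $ i)) + - 1 * z i) \<in> ratfun K D"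
      by (intro rat f m1 subfield_of_int K(1))
    show "(\<Sum>a\<in>A. f a z * of_int (a $ i)) + - 1 * z i = 0" if "z \<in> S" "D z \<noteq> 0" for z
    proof -
      have "(\<Sum>a\<in>A. (if a \<in> A then f a z else 0) * of_int (a $ i)) = z i"
        using eqs'[OF that] unfolding fibre_eqs_def by blast
      then show ?thesis by (simp cong: sum.cong)
    qed
  qed
  moreover have "(\<Prod>a\<in>A. (f a z0 * (1 / of_real (w a))) ^ m a) +
      - 1 * (\<Prod>a\<in>A. (f a z0 * (1 / of_real (w a))) ^ m' a) = 0" if mm: "same_moments A m m'" for m m'
  proof (rule zero)
    show "(\<lambda>z. (\<Prod>a\<in>A. (f a z * (1 / of_real (w a))) ^ m a) +
      - 1 * (\<Prod>a\<in>A. (f a z * (1 / of_real (w a))) ^ m' a)) \<in> ratfun K D"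
      by (intro rat f m1 subfield_divide K K01)
    show "(\<Prod>a\<in>A. (f a z * (1 / of_real (w a))) ^ m a) +
      - 1 * (\<Prod>a\<in>A. (f a z * (1 / of_real (w a))) ^ m' a) = 0" if "z \<in> S" "D z \<noteq> 0" for z
    proof -
      have "(\<Prod>a\<in>A. ((if a \<in> A then f a z else 0) / of_real (w a)) ^ m a) =
          (\<Prod>a\<in>A. ((if a \<in> A then f a z else 0) / of_real (w a)) ^ m' a)"
        using eqs'[OF that] mm unfolding fibre_eqs_def toric_binomials_def by blast
      then show ?thesis by (simp cong: prod.cong)
    qed
  qed
  ultimately show ?thesis
    unfolding fibre_eqs_def toric_binomials_def f_def[symmetric]
    by (simp cong: sum.cong prod.cong)
qed

end

section \<open>Rational linear precision\<close>

context
  fixes A :: "(int ^ 'd::finite) set" and w :: "int ^ 'd \<Rightarrow> real"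
    and g :: "real ^ 'd \<Rightarrow> int ^ 'd \<Rightarrow> real"
  assumes A: "finite A" "A \<noteq> {}" and w: "\<And>a. a \<in> A \<Longrightarrow> w a > 0"
    and D: "interior (lattice_polytope A) \<noteq> {}"
    and g_fibre: "\<And>x. x \<in> lattice_polytope A \<Longrightarrow>
      fibre_eqs A w (cvec x) (\<lambda>a. complex_of_real (g x a))"
begin

text \<open>Where all denominators are nonzero, the quotients P a / Q a are the only solution:
  uniqueness holds since a form encoding the identity vanishes on Y, existence since the fibre
  equations hold over the real interior points.\<close>

lemma rational_imp_ml_degree_1:
  assumes g_onto: "\<And>t. (\<And>i. t $ i > 0) \<Longrightarrow>
      \<exists>x\<in>lattice_polytope A. \<exists>c. c \<noteq> 0 \<and> monomial_vec A w t = (\<lambda>a. c * g x a)"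
    and rat: "\<And>a. a \<in> A \<Longrightarrow> rational_on (lattice_polytope A) (\<lambda>x. g x a)"
  shows "has_ml_degree A w 1"
proof -
  let ?D = "lattice_polytope A"
  define rep where "rep a P Q \<longleftrightarrow> P \<in> polyfun UNIV \<and> Q \<in> polyfun UNIV \<and> (\<exists>z. Q z \<noteq> 0) \<and>
      (\<forall>x\<in>?D. Q (cvec x) \<noteq> 0 \<longrightarrow> complex_of_real (g x a) = P (cvec x) / Q (cvec x))" for a P Q
  have "\<exists>P Q. rep a P Q" if a: "a \<in> A" for a
  proof -
    obtain p q where pq: "real_polynomial_function p" "real_polynomial_function q"
      "\<exists>x. q x \<noteq> 0" "\<And>x. x \<in> ?D \<Longrightarrow> q x \<noteq> 0 \<Longrightarrow> g x a = p x / q x"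
      using rat[OF a] unfolding rational_on_def by blast
    obtain P where P: "P \<in> polyfun UNIV" "\<And>x. P (cvec x) = complex_of_real (p x)"
      using real_polynomial_function_complexify[OF pq(1)] by blast
    obtain Q where Q: "Q \<in> polyfun UNIV" "\<And>x. Q (cvec x) = complex_of_real (q x)"
      using real_polynomial_function_complexify[OF pq(2)] by blast
    have "\<exists>z. Q z \<noteq> 0" using pq(3) Q(2) by (metis of_real_eq_0_iff)
    moreover have "\<forall>x\<in>?D. Q (cvec x) \<noteq> 0 \<longrightarrow> complex_of_real (g x a) = P (cvec x) / Q (cvec x)"
      using pq(4) by (simp add: P(2) Q(2))
    ultimately show ?thesis using P(1) Q(1) unfolding rep_def by blast
  qed
  then obtain P Q where "\<And>a. a \<in> A \<Longrightarrow> rep a (P a) (Q a)" by metis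
  then have P: "\<And>a. a \<in> A \<Longrightarrow> P a \<in> polyfun UNIV"
    and Q: "\<And>a. a \<in> A \<Longrightarrow> Q a \<in> polyfun UNIV" "\<And>a. a \<in> A \<Longrightarrow> \<exists>z. Q a z \<noteq> 0"
    and gPQ: "\<And>a x. a \<in> A \<Longrightarrow> x \<in> ?D \<Longrightarrow> Q a (cvec x) \<noteq> 0 \<Longrightarrow>
      complex_of_real (g x a) = P a (cvec x) / Q a (cvec x)"
    unfolding rep_def by blast+
  \<comment> \<open>The leading and the remaining coordinates of the tautological projection; the
    ratios v i / s are the affine coordinates of the image point.\<close>
  define s where "s y = (\<Sum>a\<in>A. y a)" for y :: "int ^ 'd \<Rightarrow> complex"
  define v where "v i y = (\<Sum>a\<in>A. y a * of_int (a $ i))" for i and y :: "int ^ 'd \<Rightarrow> complex"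
  have sf: "homogeneous_form A 1 s"
    unfolding s_def by (intro homogeneous_form_sum homogeneous_form_coord A)
  have vf: "homogeneous_form A 1 (v i)" for i
    unfolding v_def
    by (subst mult.commute)
      (intro homogeneous_form_sum homogeneous_form_smult homogeneous_form_coord A)
  have unique: "y a = P a z / Q a z" if a: "a \<in> A" and y: "fibre_eqs A w z y" and Qz: "Q a z \<noteq> 0"
    for a z y
  proof -
    obtain n H where H: "homogeneous_form A n H"
      "\<And>y. s y \<noteq> 0 \<Longrightarrow> H y = s y ^ n * P a (\<lambda>i. v i y / s y)"
      using homogenize[where v = v, OF P[OF a] sf vf] by blast
    obtain k L where L: "homogeneous_form A k L"
      "\<And>y. s y \<noteq> 0 \<Longrightarrow> L y = s y ^ k * Q a (\<lambda>i. v i y / s y)"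
      using homogenize[where v = v, OF Q(1)[OF a] sf vf] by blast
    \<comment> \<open>The extra factor \<open>L\<close> accounts for the points where the denominator vanishes.\<close>
    define E where "E y = L y * ((y a * L y) * s y ^ n - (s y * s y ^ k) * H y)" for y
    have "homogeneous_form A (1 + k + n) (\<lambda>y. (y a * L y) * s y ^ n)"
      using homogeneous_form_mult[OF homogeneous_form_mult[OF homogeneous_form_coord[OF A(1) a] L(1)]
          homogeneous_form_power[OF sf, of n]] by simp
    moreover have "homogeneous_form A (1 + k + n) (\<lambda>y. (s y * s y ^ k) * H y)"
      using homogeneous_form_mult[OF homogeneous_form_mult[OF sf
          homogeneous_form_power[OF sf, of k]] H(1)] by simp
    ultimately have Ef: "homogeneous_form A (k + (1 + k + n)) E"
      unfolding E_def by (rule homogeneous_form_mult[OF L(1) homogeneous_form_diff])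
    have "E y = 0"
    proof (rule form_vanishes_on_toric_Y[where w = w, OF A w Ef])
      show "proj_point y \<in> toric_Y A w" using fibre_eqs_mem_fibre[where w = w, OF A w y] by blast
      show "y \<in> proj_point y" by (rule proj_point_self)
      fix t :: "real ^ 'd" assume t: "\<And>i. t $ i > 0"
      obtain x c where x: "x \<in> ?D" "c \<noteq> 0" "monomial_vec A w t = (\<lambda>a. c * g x a)"
        using g_onto[OF t] by blast
      let ?y = "\<lambda>a. complex_of_real (monomial_vec A w t a)"
      let ?c = "complex_of_real c"
      have y: "?y = (\<lambda>a. ?c * of_real (g x a))" by (simp add: x(3))
      have sy: "s ?y = ?c"
        using g_fibre[OF x(1)] by (simp add: y s_def fibre_eqs_def flip: sum_distrib_left)
      have vy: "v i ?y = ?c * cvec x i" for i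
        using g_fibre[OF x(1)]
        by (simp add: y v_def fibre_eqs_def mult.assoc flip: sum_distrib_left)
      \<comment> \<open>The point of the torus lies over x: this is where the section property of g
        enters.\<close>
      have arg: "(\<lambda>i. v i ?y / ?c) = cvec x" using x(2) by (simp add: vy)
      have Hy: "H ?y = ?c ^ n * P a (cvec x)" using H(2)[of ?y] x(2) unfolding sy arg by simp
      have Ly: "L ?y = ?c ^ k * Q a (cvec x)" using L(2)[of ?y] x(2) unfolding sy arg by simp
      show "E ?y = 0"
      proof (cases "Q a (cvec x) = 0")
        case True
        then show ?thesis by (simp add: E_def Ly)
      next
        case False
        have "?y a = ?c * (P a (cvec x) / Q a (cvec x))"
          using gPQ[OF a x(1) False] fun_cong[OF y, of a] by (simp only:)
        then show ?thesis using False by (simp only: E_def Ly Hy sy) simp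
      qed
    qed
    moreover have "s y = 1" "(\<lambda>i. v i y / s y) = z"
      using y by (simp_all add: s_def v_def fibre_eqs_def)
    ultimately show ?thesis using Qz H(2)[of y] L(2)[of y] by (simp add: E_def field_simps)
  qed
  have exists: "fibre_eqs A w z (\<lambda>a. if a \<in> A then P a z / Q a z else 0)"
    if "\<And>a. a \<in> A \<Longrightarrow> Q a z \<noteq> 0" for z
  proof (rule fibre_eqs_transfer[where w = w and K = UNIV and S = "cvec ` interior ?D", OF A w])
    show "complex_subfield UNIV" by (simp add: complex_subfield_def)
    \<comment> \<open>The real interior points are Zariski dense in complex affine space, so the
      equations reach every admissible complex z.\<close>
    show "R z = 0" if "R \<in> polyfun UNIV" "\<And>z. z \<in> cvec ` interior ?D \<Longrightarrow> R z = 0" for R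
      using polyfun_eq_0_if_vanishes_on_open[OF that(1) open_interior D] that(2) by blast
    fix z' assume "z' \<in> cvec ` interior ?D" and Qz: "\<And>a. a \<in> A \<Longrightarrow> Q a z' \<noteq> 0"
    then obtain x where x: "x \<in> ?D" "z' = cvec x" using interior_subset by blast
    have "(\<lambda>a. complex_of_real (g x a)) = (\<lambda>a. if a \<in> A then P a z' / Q a z' else 0)"
    proof
      fix a show "complex_of_real (g x a) = (if a \<in> A then P a z' / Q a z' else 0)"
        using gPQ[of a x] g_fibre[OF x(1)] Qz[of a] x by (simp add: fibre_eqs_def)
    qed
    then show "fibre_eqs A w z' (\<lambda>a. if a \<in> A then P a z' / Q a z' else 0)"
      using g_fibre[OF x(1)] x(2) by simp
  qed (use P Q that in auto)
  have one: "homogeneous_form (UNIV :: 'd option set) 1 (\<lambda>y. y j)" for j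
    by (rule homogeneous_form_coord) auto
  define hgz where "hgz a k L \<longleftrightarrow> homogeneous_form (UNIV :: 'd option set) k L \<and>
      (\<forall>y. y None \<noteq> 0 \<longrightarrow> L y = y None ^ k * Q a (\<lambda>i. y (Some i) / y None))" for a k L
  have "\<exists>k L. hgz a k L" if "a \<in> A" for a
    unfolding hgz_def by (rule homogenize[where v = "\<lambda>i y. y (Some i)", OF Q(1)[OF that] one one])
  then obtain k L where "\<And>a. a \<in> A \<Longrightarrow> hgz a (k a) (L a)" by metis
  then have L: "\<And>a. a \<in> A \<Longrightarrow> homogeneous_form (UNIV :: 'd option set) (k a) (L a)"
    "\<And>a y. a \<in> A \<Longrightarrow> y None \<noteq> 0 \<Longrightarrow> L a y = y None ^ k a * Q a (\<lambda>i. y (Some i) / y None)"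
    unfolding hgz_def by blast+
  \<comment> \<open>The factor \<open>y None\<close> removes the hyperplane at infinity, the others
    the zeros of the denominators.\<close>
  define G where "G y = y None * (\<Prod>a\<in>A. L a y)" for y
  have Gf: "homogeneous_form UNIV (1 + (\<Sum>a\<in>A. k a)) G"
    unfolding G_def by (intro homogeneous_form_mult one homogeneous_form_prod A L)
  have G_affine: "G (affine_point z) = (\<Prod>a\<in>A. Q a z)" for z
    using L(2)[of _ "affine_point z"] by (simp add: G_def affine_point_def)
  define U where "U = {p \<in> proj_space (UNIV :: 'd option set). \<exists>y\<in>p. G y \<noteq> 0}"
  have "zariski_open UNIV U"
    unfolding zariski_open_def zariski_closed_def U_def
    by (intro conjI exI[of _ "{G}"]) (use Gf in auto)
  moreover have "U \<noteq> {}"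
  proof -
    have "\<exists>x\<in>UNIV. \<forall>R\<in>Q ` A. R (cvec x) \<noteq> 0"
      by (rule countable_polyfun_common_nonzero) (use Q A in \<open>auto intro: countable_finite\<close>)
    then obtain x where "G (affine_point (cvec x)) \<noteq> 0" using A(1) by (auto simp: G_affine)
    moreover have "affine_point (cvec x) \<in> nonzero_vecs UNIV"
      by (auto simp: nonzero_vecs_def affine_point_def intro: exI[of _ None])
    ultimately show ?thesis
      unfolding U_def proj_space_def using proj_point_self by blast
  qed
  moreover have "finite {p \<in> toric_Y A w. tautological_proj A p = u} \<and>
      card {p \<in> toric_Y A w. tautological_proj A p = u} = 1" if uU: "u \<in> U" for u
  proof -
    obtain y0 y where u: "u = proj_point y0" "y \<in> u" "G y \<noteq> 0"
      using uU unfolding U_def proj_space_def by blast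
    obtain c where c: "c \<noteq> 0" "y = (\<lambda>j. c * y0 j)" using u(2) unfolding u(1) by (rule proj_pointE)
    have y_None: "y None \<noteq> 0" using u(3) by (auto simp: G_def)
    define z where "z = (\<lambda>i. y (Some i) / y None)"
    have "y = (\<lambda>j. y None * affine_point z j)"
    proof
      fix j show "y j = y None * affine_point z j"
        using y_None by (cases j) (auto simp: z_def affine_point_def)
    qed
    then have y: "proj_point y = proj_point (affine_point z)"
      using proj_point_scale[OF y_None] by metis
    have uz: "u = proj_point (affine_point z)"
      using proj_point_scale[OF c(1), of y0] y unfolding u(1) c(2)[symmetric] by simp
    have Qz: "Q a z \<noteq> 0" if "a \<in> A" for a
      using u(3) L(2)[of a y, OF that y_None] that A(1) by (auto simp: G_def z_def)
    have "\<exists>!y. fibre_eqs A w z y"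
    proof
      show "fibre_eqs A w z (\<lambda>a. if a \<in> A then P a z / Q a z else 0)" using exists Qz by blast
      fix y assume y: "fibre_eqs A w z y"
      show "y = (\<lambda>a. if a \<in> A then P a z / Q a z else 0)"
      proof
        fix a show "y a = (if a \<in> A then P a z / Q a z else 0)"
          using unique[OF _ y, of a] Qz[of a] y by (simp add: fibre_eqs_def)
      qed
    qed
    then show ?thesis unfolding uz using fibre_card_1_iff[where w = w, OF A w] by blast
  qed
  ultimately show ?thesis unfolding has_ml_degree_def rational_map_degree_def by blast
qed

text \<open>The nonempty open set contains a point where one of the forms defining its complement is
  nonzero. Its restriction to the affine chart is the required polynomial; the work is to show that
  it is not identically zero there.\<close>

lemma ml_degree_1_generic_unique:
  assumes "has_ml_degree A w 1"
  shows "\<exists>P\<in>polyfun UNIV. (\<exists>z. P z \<noteq> 0) \<and> (\<forall>z. P z \<noteq> 0 \<longrightarrow> (\<exists>!y. fibre_eqs A w z y))"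
proof -
  obtain U where U: "zariski_open (UNIV :: 'd option set) U" "U \<noteq> {}"
    "\<And>u. u \<in> U \<Longrightarrow> finite {p \<in> toric_Y A w. tautological_proj A p = u} \<and>
      card {p \<in> toric_Y A w. tautological_proj A p = u} = 1"
    using assms unfolding has_ml_degree_def rational_map_degree_def by blast
  obtain \<F> where sub: "U \<subseteq> proj_space UNIV" and \<F>: "\<forall>F\<in>\<F>. \<exists>n. homogeneous_form UNIV n F"
    "proj_space UNIV - U = {p \<in> proj_space UNIV. \<forall>F\<in>\<F>. \<forall>y\<in>p. F y = 0}"
    using U(1) unfolding zariski_open_def zariski_closed_def by blast
  obtain p where p: "p \<in> U" using U(2) by blast
  then have "p \<notin> {p \<in> proj_space UNIV. \<forall>F\<in>\<F>. \<forall>y\<in>p. F y = 0}" unfolding \<F>(2)[symmetric] by simp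
  then obtain F y0 where F: "F \<in> \<F>" "F y0 \<noteq> 0" using p sub by blast
  then obtain n where Fn: "homogeneous_form UNIV n F" using \<F>(1) by blast
  have Fp: "F \<in> polyfun UNIV" by (rule homogeneous_form_polyfun[OF finite Fn])
  have aff: "(\<lambda>z. affine_point z j) \<in> polyfun UNIV" for j :: "'d option"
    by (cases j) (auto simp: affine_point_def intro: polyfun.const polyfun.coord)
  have "(\<lambda>z. F (affine_point z)) \<in> polyfun UNIV"
    using polyfun_subst[OF Fp aff] by simp
  moreover have "\<exists>z. F (affine_point z) \<noteq> 0"
  proof (rule ccontr)
    assume *: "\<not> (\<exists>z. F (affine_point z) \<noteq> 0)"
    have F0: "F y = 0" if "y None \<noteq> 0" for y
    proof -
      have "y = (\<lambda>j. y None * affine_point (\<lambda>i. y (Some i) / y None) j)"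
      proof
        fix j show "y j = y None * affine_point (\<lambda>i. y (Some i) / y None) j"
          using that by (cases j) (auto simp: affine_point_def)
      qed
      then have "F y = y None ^ n * F (affine_point (\<lambda>i. y (Some i) / y None))"
        using homogeneous_form_scale[OF Fn, of "y None" "affine_point (\<lambda>i. y (Some i) / y None)"]
        by simp
      then show ?thesis using * by simp
    qed
    \<comment> \<open>Moving y0 along the leading coordinate enters the chart at once, even if y0
      lies at infinity.\<close>
    obtain q where q: "\<And>t. F (\<lambda>j. y0 j + t * (if j = None then 1 else 0)) = poly q t"
      using polyfun_line[OF Fp, of y0 "\<lambda>j. if j = None then 1 else 0"] by blast
    \<comment> \<open>The only parameter that leaves the chart is - y0 None, which is 0 or has
      modulus \<open>norm (y0 None)\<close>; neither lies strictly between 0 and e.\<close>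
    define e where "e = (if y0 None = 0 then 1 else norm (y0 None))"
    have "q = 0"
    proof (rule poly_eq_0_if_vanishes_near_0)
      show "e > 0" by (simp add: e_def)
      fix t :: real assume t: "0 < t" "t < e"
      have "y0 None + of_real t \<noteq> 0"
      proof
        assume "y0 None + of_real t = 0"
        then have eq: "y0 None = - of_real t" by (simp add: eq_neg_iff_add_eq_0)
        then have "norm (y0 None) = t" using t by simp
        then show False using t eq by (auto simp: e_def)
      qed
      then show "poly q (of_real t) = 0" unfolding q[symmetric] by (intro F0) simp
    qed
    then have "F y0 = 0" using q[of 0] by simp
    then show False using F(2) by simp
  qed
  moreover have "\<exists>!y. fibre_eqs A w z y" if z: "F (affine_point z) \<noteq> 0" for z
  proof -
    have "affine_point z \<in> nonzero_vecs UNIV"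
      by (auto simp: nonzero_vecs_def affine_point_def intro: exI[of _ None])
    then have 1: "proj_point (affine_point z) \<in> proj_space UNIV" by (simp add: proj_space_def)
    have "proj_point (affine_point z) \<notin> proj_space UNIV - U"
      unfolding \<F>(2) using z F(1) proj_point_self[of "affine_point z"] by blast
    then have "proj_point (affine_point z) \<in> U" using 1 by simp
    then show ?thesis using U(3) fibre_card_1_iff[where w = w, OF A w] by blast
  qed
  ultimately show ?thesis by (intro bexI[of _ "\<lambda>z. F (affine_point z)"]) auto
qed

text \<open>The equations are polynomial with coefficients built from z, the weights and integers,
  all of which \<sigma> fixes, so \<sigma> applied to every coordinate of a solution gives a
  solution.\<close>

lemma fibre_eqs_hom:
  assumes F: "complex_subfield F" and \<sigma>: "field_hom F \<sigma>" and y: "fibre_eqs A w z y"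
    and sub: "\<And>i. z i \<in> F" "\<And>a. a \<in> A \<Longrightarrow> complex_of_real (w a) \<in> F" "\<And>a. a \<in> A \<Longrightarrow> y a \<in> F"
    and fixed: "\<And>i. \<sigma> (z i) = z i" "\<And>a. a \<in> A \<Longrightarrow> \<sigma> (of_real (w a)) = of_real (w a)"
      "\<And>n. \<sigma> (of_int n) = of_int n"
  shows "fibre_eqs A w z (\<lambda>a. if a \<in> A then \<sigma> (y a) else 0)"
proof -
  have "(\<Sum>a\<in>A. \<sigma> (y a)) = \<sigma> (\<Sum>a\<in>A. y a)" using hom_sum[OF F \<sigma> A(1) sub(3)] by simp
  then have 1: "(\<Sum>a\<in>A. \<sigma> (y a)) = 1" using y hom_one[OF F \<sigma>] by (simp add: fibre_eqs_def)
  have 2: "(\<Sum>a\<in>A. \<sigma> (y a) * of_int (a $ i)) = z i" for i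
  proof -
    have "\<sigma> (\<Sum>a\<in>A. y a * of_int (a $ i)) = (\<Sum>a\<in>A. \<sigma> (y a * of_int (a $ i)))"
      by (intro hom_sum[OF F \<sigma>] A subfield_mult[OF F] sub subfield_of_int[OF F])
    also have "\<dots> = (\<Sum>a\<in>A. \<sigma> (y a) * of_int (a $ i))"
      by (intro sum.cong refl) (simp add: hom_mult[OF F \<sigma>] sub subfield_of_int[OF F] fixed)
    finally show ?thesis using y fixed(1) by (simp add: fibre_eqs_def)
  qed
  have 3: "(\<Prod>a\<in>A. (\<sigma> (y a) / of_real (w a)) ^ m a) = \<sigma> (\<Prod>a\<in>A. (y a / of_real (w a)) ^ m a)" for m
  proof -
    have "\<sigma> (\<Prod>a\<in>A. (y a / of_real (w a)) ^ m a) = (\<Prod>a\<in>A. \<sigma> ((y a / of_real (w a)) ^ m a))"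
      by (intro hom_prod[OF F \<sigma>] A subfield_power[OF F] subfield_divide[OF F] sub)
    also have "\<dots> = (\<Prod>a\<in>A. (\<sigma> (y a) / of_real (w a)) ^ m a)"
      by (intro prod.cong refl)
        (simp add: hom_power[OF F \<sigma>] hom_divide[OF F \<sigma>] subfield_divide[OF F] sub fixed)
    finally show ?thesis by simp
  qed
  have "\<sigma> (\<Prod>a\<in>A. (y a / of_real (w a)) ^ m a) = \<sigma> (\<Prod>a\<in>A. (y a / of_real (w a)) ^ m' a)"
    if "same_moments A m m'" for m m'
    using y that unfolding fibre_eqs_def toric_binomials_def by (intro arg_cong[of _ _ \<sigma>]) blast
  then show ?thesis
    using 1 2 3 unfolding fibre_eqs_def toric_binomials_def by (simp cong: sum.cong prod.cong)
qed

lemma ml_degree_1_imp_rational: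
  assumes "has_ml_degree A w 1" and a: "a \<in> A"
  shows "rational_on (lattice_polytope A) (\<lambda>x. g x a)"
proof -
  let ?D = "lattice_polytope A"
  obtain P0 where P0: "P0 \<in> polyfun UNIV" "\<exists>z. P0 z \<noteq> 0"
    "\<And>z. P0 z \<noteq> 0 \<Longrightarrow> \<exists>!y. fibre_eqs A w z y"
    using ml_degree_1_generic_unique[OF assms(1)] by blast
  \<comment> \<open>Polynomials with constants from {0, 1, -1} are those with integer coefficients,
    so \<open>adjoin B W\<close> is the field generated by the weights over the rationals.\<close>
  define B :: "complex set" where "B = {0, 1, - 1}"
  define W where "W = (\<lambda>a. if a \<in> A then complex_of_real (w a) else 0)"
  define K0 where "K0 = adjoin B W"
  have B: "0 \<in> B" "1 \<in> B" "- 1 \<in> B" "countable B" "B \<subseteq> \<real>" by (auto simp: B_def)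
  have K0: "complex_subfield K0" "countable K0" "K0 \<subseteq> \<real>"
    unfolding K0_def using B by (intro complex_subfield_adjoin countable_adjoin adjoin_real; simp add: W_def)+
  have wK0: "complex_of_real (w b) \<in> K0" if "b \<in> A" for b
    using adjoin_coord[OF B(2), of W b] that by (simp add: K0_def W_def)
  have K0': "0 \<in> K0" "1 \<in> K0" "- 1 \<in> K0"
    unfolding K0_def by (intro adjoin_base B)+
  define \<P> where "\<P> = insert P0 {R \<in> polyfun K0. \<exists>z. R z \<noteq> 0}"
  have "\<exists>u\<in>interior ?D. \<forall>R\<in>\<P>. R (cvec u) \<noteq> 0"
  proof (rule countable_polyfun_common_nonzero)
    show "countable \<P>"
      unfolding \<P>_def using countable_polyfun[OF K0(2)]
      by (intro countable_insert) (rule countable_subset[rotated], auto)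
    show "\<P> \<subseteq> polyfun UNIV" using P0(1) polyfun_mono[of _ K0 UNIV] by (auto simp: \<P>_def)
  qed (use P0(2) D in \<open>auto simp: \<P>_def\<close>)
  then obtain u where u: "u \<in> interior ?D" "P0 (cvec u) \<noteq> 0"
    and generic: "\<And>R z. R \<in> polyfun K0 \<Longrightarrow> R (cvec u) = 0 \<Longrightarrow> R z = 0"
    unfolding \<P>_def by blast
  define K where "K = adjoin K0 (cvec u)"
  have K: "complex_subfield K" "countable K"
    unfolding K_def using K0' K0(2) by (intro complex_subfield_adjoin countable_adjoin; simp)+
  have K0K: "c \<in> K" if "c \<in> K0" for c using adjoin_base[OF K0'(2) that] by (simp add: K_def)
  have uK: "cvec u i \<in> K" for i using adjoin_coord[OF K0'(2)] by (simp add: K_def)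
  define y where "y = (\<lambda>b. complex_of_real (g u b))"
  have y: "fibre_eqs A w (cvec u) y" using g_fibre u(1) interior_subset by (auto simp: y_def)
  have yK: "y b \<in> K" if b: "b \<in> A" for b
  proof (rule ccontr)
    assume "y b \<notin> K"
    \<comment> \<open>The field contains every coordinate of the solution, because \<sigma> must be
      applied to all of them to give another solution.\<close>
    then obtain F \<sigma> where F: "complex_subfield F" "K \<subseteq> F" "insert (y b) (y ` A) \<subseteq> F" "field_hom F \<sigma>"
      and fixed: "\<forall>x\<in>K. \<sigma> x = x" and move: "\<sigma> (y b) \<noteq> y b"
      using hom_move_finite[OF finite_imageI[OF A(1)] K] by blast
    have "fibre_eqs A w (cvec u) (\<lambda>a. if a \<in> A then \<sigma> (y a) else 0)"
      by (rule fibre_eqs_hom[OF F(1,4) y])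
        (use F(2,3) fixed uK wK0 K0K subfield_of_int[OF K(1)] in auto)
    then have "(\<lambda>a. if a \<in> A then \<sigma> (y a) else 0) = y" using P0(3)[OF u(2)] y by blast
    from fun_cong[OF this, of b] show False using move b by simp
  qed
  define rep where "rep b P Q \<longleftrightarrow> P \<in> polyfun K0 \<and> Q \<in> polyfun K0 \<and>
      y b = P (cvec u) / Q (cvec u) \<and> Q (cvec u) \<noteq> 0" for b P Q
  have "\<exists>P Q. rep b P Q" if b: "b \<in> A" for b
    using yK[OF b] unfolding K_def rep_def by (rule adjoinE[OF _ K0'(1,2)]) blast
  then obtain P Q where "\<And>b. b \<in> A \<Longrightarrow> rep b (P b) (Q b)" by metis
  then have P: "\<And>b. b \<in> A \<Longrightarrow> P b \<in> polyfun K0"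
    and Q: "\<And>b. b \<in> A \<Longrightarrow> Q b \<in> polyfun K0" "\<And>b. b \<in> A \<Longrightarrow> Q b (cvec u) \<noteq> 0"
    and yPQ: "\<And>b. b \<in> A \<Longrightarrow> y b = P b (cvec u) / Q b (cvec u)"
    unfolding rep_def by blast+
  have y_eq: "y = (\<lambda>a. if a \<in> A then P a (cvec u) / Q a (cvec u) else 0)"
    using yPQ y by (auto simp: fibre_eqs_def)
  have PQ: "fibre_eqs A w z (\<lambda>a. if a \<in> A then P a z / Q a z else 0)"
    if "\<And>b. b \<in> A \<Longrightarrow> Q b z \<noteq> 0" for z
  proof (rule fibre_eqs_transfer[where w = w and K = K0 and S = "{cvec u}", OF A w])
    show "fibre_eqs A w z' (\<lambda>a. if a \<in> A then P a z' / Q a z' else 0)" if "z' \<in> {cvec u}" for z'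
    proof -
      have "z' = cvec u" using that by simp
      then show ?thesis using y unfolding y_eq by (simp only:)
    qed
    \<comment> \<open>Since u is generic over K0, a polynomial over K0 that vanishes at this one
      point is identically zero.\<close>
    show "R z = 0" if "R \<in> polyfun K0" "\<And>z. z \<in> {cvec u} \<Longrightarrow> R z = 0" for R
      using generic that by blast
  qed (use K0 wK0 P Q that in auto)
  \<comment> \<open>K0 is real, so P b and Q b are real at real points and passing to real parts
    loses nothing.\<close>
  define p where "p b x = Re (P b (cvec x))" for b x
  define q where "q b x = Re (Q b (cvec x))" for b x
  \<comment> \<open>The squared modulus of P0, a real polynomial with the same real zeros.\<close>
  define r where "r x = (Re (P0 (cvec x)))\<^sup>2 + (Im (P0 (cvec x)))\<^sup>2" for x
  have real: "complex_of_real (p b x) = P b (cvec x)" "complex_of_real (q b x) = Q b (cvec x)"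
    if "b \<in> A" for b x
    using polyfun_real[OF P[OF that] K0(3), of "cvec x"] polyfun_real[OF Q(1)[OF that] K0(3), of "cvec x"]
    by (simp_all add: p_def q_def cvec_def)
  have poly: "real_polynomial_function (p b)" "real_polynomial_function (q b)" if "b \<in> A" for b
    using polyfun_real_polynomial_function[OF P[OF that]]
      polyfun_real_polynomial_function[OF Q(1)[OF that]] by (simp_all add: p_def[abs_def] q_def[abs_def])
  have r: "real_polynomial_function r"
    unfolding r_def[abs_def] using polyfun_real_polynomial_function[OF P0(1)]
    by (intro real_polynomial_function.intros(3) real_polynomial_function_power) auto
  have r0: "r x = 0 \<longleftrightarrow> P0 (cvec x) = 0" for x
    by (simp add: r_def sum_power2_eq_zero_iff complex_eq_iff)
  \<comment> \<open>Numerator and denominator are both multiplied by s. As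
    \<open>rational_on\<close> constrains only points with nonzero denominator, this limits the
    claim to points where all quotients are defined and the fibre is a single point.\<close>
  define s where "s x = (\<Prod>b\<in>A. q b x) * r x" for x
  have s: "real_polynomial_function s"
    unfolding s_def[abs_def] using poly(2) A(1)
    by (intro real_polynomial_function.intros(4) real_polynomial_function_prod r) auto
  show ?thesis
    unfolding rational_on_def
  proof (intro exI conjI ballI impI)
    show "real_polynomial_function (\<lambda>x. p a x * s x)" "real_polynomial_function (\<lambda>x. q a x * s x)"
      by (intro real_polynomial_function.intros(4) poly a s)+
    have "q b u \<noteq> 0" if "b \<in> A" for b using real(2)[OF that, of u] Q(2)[OF that] by auto
    then show "q a u * s u \<noteq> 0" using u(2) a A(1) by (simp add: s_def r0)
    fix x assume x: "x \<in> ?D" and nz: "q a x * s x \<noteq> 0"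
    then have "P0 (cvec x) \<noteq> 0" by (auto simp: s_def r0)
    moreover have Qx: "Q b (cvec x) \<noteq> 0" if "b \<in> A" for b
      using nz that A(1) unfolding real(2)[OF that, symmetric] by (auto simp: s_def)
    ultimately have "(\<lambda>b. complex_of_real (g x b)) =
        (\<lambda>b. if b \<in> A then P b (cvec x) / Q b (cvec x) else 0)"
      using P0(3)[of "cvec x"] g_fibre[OF x] PQ[of "cvec x"] by blast
    from fun_cong[OF this, of a] have "complex_of_real (g x a) = P a (cvec x) / Q a (cvec x)"
      using a by simp
    also have "\<dots> = complex_of_real (p a x / q a x)" by (simp add: real[OF a])
    finally have "g x a = p a x / q a x" by (simp only: of_real_eq_iff)
    then show "g x a = p a x * s x / (q a x * s x)" using nz by simp
  qed
qed

end

section \<open>Toric patches as sections of the tautological projection\<close>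

lemma blending_sum_pos:
  assumes A: "finite A" and tp: "toric_patch A w \<beta>" and x: "x \<in> lattice_polytope A"
  shows "(\<Sum>b\<in>A. \<beta> b x) > 0"
proof -
  obtain a where a: "a \<in> A" "\<beta> a x \<noteq> 0" using tp x unfolding toric_patch_def patch_def by blast
  have nn: "\<beta> b x \<ge> 0" if "b \<in> A" for b
    using tp x that unfolding toric_patch_def patch_def by blast
  then have "\<beta> a x > 0" using a by (simp add: less_le)
  then show ?thesis using nn A a(1) by (intro sum_pos2) auto
qed

context
  fixes A :: "(int ^ 'd::finite) set" and w :: "int ^ 'd \<Rightarrow> real"
    and \<beta> :: "int ^ 'd \<Rightarrow> real ^ 'd \<Rightarrow> real" and \<psi> \<phi> g
  assumes A: "finite A" "A \<noteq> {}" and w: "\<And>a. a \<in> A \<Longrightarrow> w a > 0"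
    and tp: "toric_patch A w \<beta>"
    and hom: "homeomorphism (lattice_polytope A) (lattice_polytope A) \<psi> \<phi>"
    and lp: "linear_precision A (reparametrize \<beta> \<psi>)"
  defines "g \<equiv> \<lambda>x a. if a \<in> A then normalize_patch A (reparametrize \<beta> \<psi>) a x else 0"
begin

lemma normalized_blending_eq:
  "g x = (\<lambda>a. inverse (\<Sum>b\<in>A. \<beta> b (\<psi> x)) * (if a \<in> A then \<beta> a (\<psi> x) else 0))"
  by (auto simp: g_def normalize_patch_def reparametrize_def divide_inverse)

text \<open>The binomials hold since the patch maps into X, the sum is 1 by normalization, and
  linear precision for the coordinate functions gives the moments.\<close>

lemma precise_patch_fibre_eqs:
  assumes x: "x \<in> lattice_polytope A"
  shows "fibre_eqs A w (cvec x) (\<lambda>a. complex_of_real (g x a))"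
proof -
  let ?s = "\<Sum>b\<in>A. \<beta> b (\<psi> x)"
  let ?b = "\<lambda>a. if a \<in> A then \<beta> a (\<psi> x) else 0"
  have \<psi>x: "\<psi> x \<in> lattice_polytope A" using hom x unfolding homeomorphism_def by blast
  have s: "?s > 0" by (rule blending_sum_pos[OF A(1) tp \<psi>x])
  have "proj_point ?b \<in> toric_X A w" using tp \<psi>x unfolding toric_patch_def by blast
  then have Y: "proj_point (\<lambda>a. complex_of_real (?b a)) \<in> toric_Y A w"
    by (rule toric_X_complexify[where w = w, OF A w, rotated])
  have "(\<lambda>a. complex_of_real (g x a)) = (\<lambda>a. complex_of_real (inverse ?s) * complex_of_real (?b a))"
    unfolding normalized_blending_eq of_real_mult ..
  moreover have nz: "complex_of_real (inverse ?s) \<noteq> 0"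
    unfolding of_real_eq_0_iff using s by simp
  ultimately have "proj_point (\<lambda>a. complex_of_real (g x a)) = proj_point (\<lambda>a. complex_of_real (?b a))"
    by (simp only: proj_point_scale[OF nz])
  then have "toric_binomials A w (\<lambda>a. complex_of_real (g x a))"
    using toric_Y_imp_binomials[where w = w, OF A w Y]
      proj_point_self[of "\<lambda>a. complex_of_real (g x a)"] by simp
  moreover have "(\<Sum>a\<in>A. complex_of_real (g x a)) = 1"
  proof -
    have "(\<Sum>a\<in>A. g x a) = (\<Sum>a\<in>A. \<beta> a (\<psi> x) / ?s)"
      by (rule sum.cong) (simp_all add: g_def normalize_patch_def reparametrize_def)
    also have "\<dots> = 1" using s by (simp flip: sum_divide_distrib)
    finally show ?thesis unfolding of_real_sum[symmetric] by (simp only: of_real_1)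
  qed
  moreover have "(\<Sum>a\<in>A. complex_of_real (g x a) * of_int (a $ i)) = cvec x i" for i
  proof -
    have "linear (\<lambda>x :: real ^ 'd. x $ i)" by (rule bounded_linear.linear[OF bounded_linear_vec_nth])
    then have "x $ i + 0 = (\<Sum>a\<in>A. normalize_patch A (reparametrize \<beta> \<psi>) a x * (real_vec a $ i + 0))"
      using lp x unfolding linear_precision_def by blast
    then have "x $ i = (\<Sum>a\<in>A. g x a * of_int (a $ i))"
      by (simp add: g_def real_vec_def cong: sum.cong)
    from arg_cong[OF this, of complex_of_real] show ?thesis
      unfolding of_real_sum of_real_mult of_real_of_int_eq by (simp only: cvec_def)
  qed
  moreover have "complex_of_real (g x a) = 0" if "a \<notin> A" for a using that by (simp add: g_def)
  ultimately show ?thesis unfolding fibre_eqs_def by blast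
qed

text \<open>A toric patch covers all of X, hence every point of the torus image; \<phi> turns the
  parameter of the original patch into one for the reparametrization.\<close>

lemma precise_patch_onto:
  assumes t: "\<And>i. t $ i > 0"
  shows "\<exists>x\<in>lattice_polytope A. \<exists>c. c \<noteq> 0 \<and> monomial_vec A w t = (\<lambda>a. c * g x a)"
proof -
  let ?b = "\<lambda>z a. if a \<in> A then \<beta> a z else 0"
  have "proj_point (monomial_vec A w t) \<in> toric_X A w"
    by (rule monomial_vec_in_toric_X[where w = w, OF A w t])
  then obtain z where z: "z \<in> lattice_polytope A" "proj_point (monomial_vec A w t) = proj_point (?b z)"
    using tp unfolding toric_patch_def by blast
  obtain c where c: "c \<noteq> 0" "monomial_vec A w t = (\<lambda>a. c * ?b z a)"
    using proj_point_eqD[OF z(2)[symmetric]] by blast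
  have x: "\<phi> z \<in> lattice_polytope A" "\<psi> (\<phi> z) = z"
    using hom z(1) unfolding homeomorphism_def by auto
  let ?s = "\<Sum>b\<in>A. \<beta> b z"
  have "?s > 0" by (rule blending_sum_pos[OF A(1) tp z(1)])
  then have "monomial_vec A w t = (\<lambda>a. (c * ?s) * g (\<phi> z) a)" "c * ?s \<noteq> 0"
    unfolding normalized_blending_eq x(2) c(2) using c(1) by auto
  then show ?thesis using x(1) by blast
qed

end

text \<open>With \<psi> inverse to the tautological map, the weighted mean of the lattice points at
  x is x itself, and affine functions commute with weighted means.\<close>

lemma proper_patch_precise_reparametrization:
  fixes A :: "(int ^ 'd::finite) set"
  assumes A: "finite A" "A \<noteq> {}" and tp: "toric_patch A w \<beta>" and pp: "proper_patch A \<beta>"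
  shows "\<exists>\<psi> \<phi>. homeomorphism (lattice_polytope A) (lattice_polytope A) \<psi> \<phi> \<and>
    linear_precision A (reparametrize \<beta> \<psi>)"
proof -
  let ?D = "lattice_polytope A"
  obtain \<psi> where \<psi>: "homeomorphism ?D ?D (tautological_map A \<beta>) \<psi>"
    using pp unfolding proper_patch_def by blast
  have "linear_precision A (reparametrize \<beta> \<psi>)"
    unfolding linear_precision_def
  proof (intro allI impI ballI)
    fix l :: "real ^ 'd \<Rightarrow> real" and c x assume l: "linear l" and x: "x \<in> ?D"
    have \<psi>x: "\<psi> x \<in> ?D" "tautological_map A \<beta> (\<psi> x) = x"
      using \<psi> x unfolding homeomorphism_def by auto
    let ?N = "\<lambda>a. normalize_patch A \<beta> a (\<psi> x)"
    have "(\<Sum>a\<in>A. ?N a) = 1"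
      using blending_sum_pos[OF A(1) tp \<psi>x(1)]
      by (simp add: normalize_patch_def flip: sum_divide_distrib)
    moreover have "l x = (\<Sum>a\<in>A. ?N a * l (real_vec a))"
    proof -
      have "l x = l (\<Sum>a\<in>A. ?N a *\<^sub>R real_vec a)"
        using \<psi>x(2) by (simp add: tautological_map_def)
      then show ?thesis using l by (simp add: linear_sum linear_cmul)
    qed
    moreover have "normalize_patch A (reparametrize \<beta> \<psi>) a x = ?N a" for a
      by (simp add: normalize_patch_def reparametrize_def)
    ultimately show "l x + c =
        (\<Sum>a\<in>A. normalize_patch A (reparametrize \<beta> \<psi>) a x * (l (real_vec a) + c))"
      by (simp add: distrib_left sum.distrib flip: sum_distrib_right)
  qed
  then show ?thesis using homeomorphism_symD[OF \<psi>] by blast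
qed

lemma interior_lattice_polytope_nonempty:
  fixes A :: "(int ^ 'd::finite) set"
  assumes "aff_dim (lattice_polytope A) = int CARD('d)"
  shows "interior (lattice_polytope A) \<noteq> {}" "A \<noteq> {}"
proof -
  have "lattice_polytope A \<noteq> {}" using assms by auto
  then show "A \<noteq> {}" by (auto simp: lattice_polytope_def)
  have "aff_dim (lattice_polytope A) = int DIM(real ^ 'd)" using assms by simp
  then have "affine hull (lattice_polytope A) = UNIV" unfolding aff_dim_eq_full .
  then have "interior (lattice_polytope A) = rel_interior (lattice_polytope A)"
    by (simp add: rel_interior_interior)
  moreover have "convex (lattice_polytope A)" by (simp add: lattice_polytope_def)
  ultimately show "interior (lattice_polytope A) \<noteq> {}"
    using \<open>lattice_polytope A \<noteq> {}\<close> by (simp add: rel_interior_eq_empty)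
qed

text \<open>Properness is assumed since the maximum likelihood degree depends on A and w only, while
  a patch of this shape may traverse X non-injectively and then is not proper.\<close>

theorem proposition4p1:
  fixes A :: "(int ^ 'd::finite) set"
    and w :: "int ^ 'd \<Rightarrow> real"
    and \<beta> :: "int ^ 'd \<Rightarrow> real ^ 'd \<Rightarrow> real"
  assumes "finite A"
    and "aff_dim (lattice_polytope A) = int CARD('d)"
    and "\<And>a. a \<in> A \<Longrightarrow> w a > 0"
    and "toric_patch A w \<beta>"
    and "proper_patch A \<beta>"
  shows "rational_linear_precision A \<beta> \<longleftrightarrow> has_ml_degree A w 1"
proof -
  note D = interior_lattice_polytope_nonempty[OF assms(2)]
  note A = assms(1) D(2)
  let ?g = "\<lambda>\<psi> x a. if a \<in> A then normalize_patch A (reparametrize \<beta> \<psi>) a x else 0"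
  show ?thesis
  proof
    assume "rational_linear_precision A \<beta>"
    then obtain \<psi> \<phi> where \<psi>: "homeomorphism (lattice_polytope A) (lattice_polytope A) \<psi> \<phi>"
      "linear_precision A (reparametrize \<beta> \<psi>)"
      and rat: "\<And>a. a \<in> A \<Longrightarrow>
        rational_on (lattice_polytope A) (normalize_patch A (reparametrize \<beta> \<psi>) a)"
      unfolding rational_linear_precision_def by blast
    show "has_ml_degree A w 1"
    proof (rule rational_imp_ml_degree_1[where w = w and g = "?g \<psi>", OF A assms(3) D(1)])
      show "rational_on (lattice_polytope A) (\<lambda>x. ?g \<psi> x a)" if "a \<in> A" for a
        using rat[OF that] that by simp
    next
      fix x assume "x \<in> lattice_polytope A"
      then show "fibre_eqs A w (cvec x) (\<lambda>a. complex_of_real (?g \<psi> x a))"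
        by (rule precise_patch_fibre_eqs[where w = w, OF A assms(3,4) \<psi>, rotated])
    next
      fix t :: "real ^ 'd" assume "\<And>i. t $ i > 0"
      then show "\<exists>x\<in>lattice_polytope A. \<exists>c. c \<noteq> 0 \<and> monomial_vec A w t = (\<lambda>a. c * ?g \<psi> x a)"
        by (rule precise_patch_onto[where w = w, OF A assms(3,4) \<psi>, rotated])
    qed
  next
    assume ml: "has_ml_degree A w 1"
    obtain \<psi> \<phi> where \<psi>: "homeomorphism (lattice_polytope A) (lattice_polytope A) \<psi> \<phi>"
      "linear_precision A (reparametrize \<beta> \<psi>)"
      using proper_patch_precise_reparametrization[OF A assms(4,5)] by blast
    have "rational_on (lattice_polytope A) (normalize_patch A (reparametrize \<beta> \<psi>) a)"
      if "a \<in> A" for a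
    proof -
      have "rational_on (lattice_polytope A) (\<lambda>x. ?g \<psi> x a)"
      proof (rule ml_degree_1_imp_rational[where w = w and g = "?g \<psi>", OF A assms(3) D(1) _ ml that])
        fix x assume "x \<in> lattice_polytope A"
        then show "fibre_eqs A w (cvec x) (\<lambda>a. complex_of_real (?g \<psi> x a))"
          by (rule precise_patch_fibre_eqs[where w = w, OF A assms(3,4) \<psi>, rotated])
      qed
      then show ?thesis using that by simp
    qed
    then show "rational_linear_precision A \<beta>"
      unfolding rational_linear_precision_def using assms(5) \<psi> by blast
  qed
qed

end
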